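(* Let $\beta$ be a Salem number of degree $6$. Then the set of positive integers $m$ such that $d_{\beta^m}(1)$ is $(1,p)$-periodic for some $p\in\mathbb N$ (so in particular $\beta^m$ is a Parry number) has lower natural density greater than $1/2$, i.e. $$ \liminf_{M\to \infty} \frac {\mathrm{Card}\left\{ m\in [1,M]\cap \mathbb Z\ \middle|\ d_{\beta^m}(1) \text{ is $(1,p)$-periodic for some } p\in \mathbb N \right\}}{M}> \frac12 . $$
   Context: A Salem number is an algebraic integer $\beta>1$ all of whose Galois conjugates have modulus at most $1$, with at least one conjugate of modulus exactly $1$. For a real $\beta>1$, the beta transformation is $T_\beta(x)=\beta x-\lfloor \beta x\rfloor$ on $[0,1)$; for $x\in[0,1)$ put $x_n=\lfloor \beta T_\beta^{n-1}(x)\rfloor$ and $d_\beta(x)=x_1x_2x_3\cdots$. The expansion of one is $d_\beta(1):=\lim_{\epsilon\downarrow 0} d_\beta(1-\epsilon)$ (limit in the product topology). An infinite word $x_1x_2\cdots$ is eventually periodic if it can be written $x_1\cdots x_m(x_{m+1}\cdots x_{m+p})^\infty$ with $m\ge 0$, $p\ge 1$; choosing $m$ and $p$ minimal, the word is called $(m,p)$-periodic. $\beta$ is a Parry number if $d_\beta(1)$ is eventually periodic. *)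

theory Defs
  imports Complex_Main "HOL-Computational_Algebra.Polynomial"
    "HOL-Library.Extended_Real" "HOL-Library.Liminf_Limsup"
begin

definition salem_number_deg :: "nat \<Rightarrow> real \<Rightarrow> bool" where
  "salem_number_deg d beta \<longleftrightarrow> beta > 1 \<and>
     (\<exists>P :: int poly. lead_coeff P = 1 \<and> degree P = d \<and>
        irreducible (map_poly rat_of_int P) \<and>
        poly (map_poly real_of_int P) beta = 0 \<and>
        (\<forall>z. poly (map_poly complex_of_int P) z = 0 \<and> z \<noteq> complex_of_real beta \<longrightarrow> cmod z \<le> 1) \<and>
        (\<exists>z. poly (map_poly complex_of_int P) z = 0 \<and> cmod z = 1))"

definition beta_T :: "real \<Rightarrow> real \<Rightarrow> real" where
  "beta_T b x = b * x - of_int \<lfloor>b * x\<rfloor>"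

text \<open>Digit sequence, indexed from 0: digit n is x_{n+1} = floor(b * T^n x).\<close>
definition beta_digits :: "real \<Rightarrow> real \<Rightarrow> nat \<Rightarrow> int" where
  "beta_digits b x n = \<lfloor>b * ((beta_T b ^^ n) x)\<rfloor>"

definition beta_exp_one :: "real \<Rightarrow> nat \<Rightarrow> int" where
  "beta_exp_one b = (THE w. \<forall>n. ((\<lambda>e. beta_digits b (1 - e) n) \<longlongrightarrow> w n) (at_right 0))"

definition periodic_from :: "(nat \<Rightarrow> int) \<Rightarrow> nat \<Rightarrow> nat \<Rightarrow> bool" where
  "periodic_from w m p \<longleftrightarrow> p \<ge> 1 \<and> (\<forall>n\<ge>m. w (n + p) = w n)"

definition mp_periodic :: "(nat \<Rightarrow> int) \<Rightarrow> nat \<Rightarrow> nat \<Rightarrow> bool" where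
  "mp_periodic w m p \<longleftrightarrow> periodic_from w m p \<and>
     (\<forall>m' p'. periodic_from w m' p' \<longrightarrow> m \<le> m') \<and>
     (\<forall>p'. periodic_from w m p' \<longrightarrow> p \<le> p')"

end

theory Submission
  imports Defs "HOL-Analysis.Analysis"
begin

text \<open>
  Let \<open>B = \<beta>\<^sup>m\<close>, let \<open>u = 2 cos (m \<theta>)\<close> and \<open>v = 2 cos (m \<phi>)\<close> be the traces of its unimodular conjugates, and put
  \<open>t = B + 1/B\<close>, \<open>s = u + v\<close>, \<open>r = 2 + u v\<close>. The minimal polynomial of \<open>B\<close> is \<open>(x\<^sup>2 - t x + 1) A(x)\<close> with
  \<open>A = x\<^sup>4 - s x\<^sup>3 + r x\<^sup>2 - s x + 1\<close>. If \<open>Q\<close> is a monic integer polynomial with constant term \<open>1\<close> and all inner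
  coefficients of \<open>Q A\<close> lie in \<open>(0, 1)\<close> (or are identically \<open>1\<close>), then for large \<open>B\<close> the coefficients of
  \<open>(x\<^sup>2 - t x + 1) A(x) Q(x)\<close> give a \<open>(1, deg Q + 5)\<close>-periodic expansion of one. Every such \<open>Q\<close> thus cuts out a region
  of pairs \<open>(u, v)\<close>, and regions of different \<open>Q\<close> are disjoint. Conjugating a relation \<open>cos (k \<theta>) = cos (l \<phi>)\<close>
  would give a cosine equal to \<open>(\<beta>\<^sup>k + \<beta>\<^sup>-\<^sup>k) / 2 > 1\<close>, so \<open>(m \<theta>, m \<phi>)\<close> is equidistributed by Weyl's criterion, and it
  remains to exhibit finitely many \<open>Q\<close> whose regions contain disjoint boxes in the angles of total measure more than \<open>1/2\<close>.
\<close>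

subsection \<open>Expansions of one\<close>

text \<open>Since x^2 - t x + 1 = (x - B)(x - 1/B), dividing by x - B leaves (x - 1/B) A(x) Q(x),
  whose coefficients are the remainders of the orbit of 1 up to a correction at the very end. For
  large B they are small perturbations of the coefficients of Q A, which no longer involve B. This
  turns a question about the powers of \<beta> into one about the pair of angles. As u and v are
  even in the angles, cosine sums suffice in Weyl's criterion and the angles can be folded into
  [0, \<pi>]. The region of a Q is bounded by curves in the angles, so its area is only bounded
  below, by boxes on a grid of mesh \<pi>/512. Each coefficient is affine in u and in v separately,
  so four corners decide a box, and integer arithmetic at scale 2^32 leaves a margin that B > 2^32
  beats. Conjugation is done without field automorphisms: irreducibility moves an integer relation
  in a single root to any other root. A relation between two angles involves two roots, so it is
  first multiplied over the remaining roots to become one in a single root.\<close>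

lemma beta_exp_one_eqI:
  fixes B :: real and r :: "nat \<Rightarrow> real" and w :: "nat \<Rightarrow> int"
  assumes B: "B > 1" and r0: "r 0 = 1"
    and rec: "\<And>n. r (Suc n) = B * r n - w n"
    and bd: "\<And>n. 0 < r (Suc n) \<and> r (Suc n) \<le> 1"
  shows "beta_exp_one B = w"
proof -
  \<comment> \<open>The expansion is the limit from below, so remainders equal to 1 are allowed: the
    orbit of 1 - e runs B^n e below r, hence strictly below 1, and the bound on e keeps it
    positive.\<close>
  have dig: "\<lfloor>B * x\<rfloor> = w n"
    if "x = r n - B ^ n * e" "e > 0" "B ^ Suc n * e < r (Suc n)" for x e n
  proof (rule floor_unique)
    have "B * x = w n + (r (Suc n) - B ^ Suc n * e)"
      unfolding that(1) by (simp add: rec algebra_simps)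
    moreover have "B ^ Suc n * e > 0" using B that(2) by simp
    ultimately show "of_int (w n) \<le> B * x" "B * x < of_int (w n) + 1"
      using that(3) bd[of n] by linarith+
  qed
  have ev: "\<forall>\<^sub>F e in at_right 0. e > 0 \<and> B ^ Suc n * e < r (Suc n)" for n
  proof -
    have "((\<lambda>e. B ^ Suc n * e) \<longlongrightarrow> B ^ Suc n * 0) (at_right 0)"
      by (intro tendsto_intros)
    then have "\<forall>\<^sub>F e in at_right 0. B ^ Suc n * e < r (Suc n)"
      using bd[of n] by (intro order_tendstoD) auto
    then show ?thesis
      using eventually_at_right_less[of "0::real"] by eventually_elim auto
  qed
  have orbit: "\<forall>\<^sub>F e in at_right 0. (beta_T B ^^ n) (1 - e) = r n - B ^ n * e" for n
  proof (induction n)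
    case 0
    then show ?case by (simp add: r0)
  next
    case (Suc n)
    then show ?case using ev[of n]
    proof eventually_elim
      case (elim e)
      then have "\<lfloor>B * (beta_T B ^^ n) (1 - e)\<rfloor> = w n" using dig by blast
      then have eq: "(beta_T B ^^ Suc n) (1 - e) = B * (beta_T B ^^ n) (1 - e) - w n"
        by (simp add: beta_T_def)
      show ?case unfolding eq elim(1) by (simp add: rec algebra_simps)
    qed
  qed
  have lim: "((\<lambda>e. beta_digits B (1 - e) n) \<longlongrightarrow> w n) (at_right 0)" for n
  proof (rule tendsto_eventually)
    show "\<forall>\<^sub>F e in at_right 0. beta_digits B (1 - e) n = w n"
      using orbit[of n] ev[of n] unfolding beta_digits_def
      by eventually_elim (use dig in blast)
  qed
  show ?thesis unfolding beta_exp_one_def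
  proof (rule the_equality)
    fix w' assume "\<forall>n. ((\<lambda>e. beta_digits B (1 - e) n) \<longlongrightarrow> w' n) (at_right 0)"
    then show "w' = w" using lim
      by (intro ext) (meson tendsto_unique trivial_limit_at_right_real)
  qed (use lim in auto)
qed

text \<open>A period p' valid from index 0 would give w p = w (p + p') = w p' = w 0. Hence no
  preperiod shorter than 1 is possible, and the least period is taken afterwards.\<close>

lemma mp_periodic_oneI:
  assumes "periodic_from w 1 p" and "w p \<noteq> w 0"
  shows "\<exists>p. mp_periodic w 1 p"
proof -
  define p0 where "p0 = (LEAST p. periodic_from w 1 p)"
  have p0: "periodic_from w 1 p0" "\<And>p'. periodic_from w 1 p' \<Longrightarrow> p0 \<le> p'"
    unfolding p0_def using assms(1) by (auto intro: LeastI Least_le)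
  have "1 \<le> m'" if "periodic_from w m' p'" for m' p'
  proof (rule ccontr)
    assume "\<not> 1 \<le> m'"
    with that have p': "p' \<ge> 1" "\<And>n. w (n + p') = w n" by (auto simp: periodic_from_def)
    have "w p = w (p + p')" by (simp add: p'(2))
    also have "\<dots> = w p'"
      using assms(1) p'(1) by (metis periodic_from_def add.commute)
    also have "\<dots> = w 0" using p'(2)[of 0] by simp
    finally show False using assms(2) by simp
  qed
  with p0 show ?thesis unfolding mp_periodic_def by blast
qed

text \<open>The value 1 - 1/B closes the cycle: multiplied by B it gives B - 1, so with a digit one
  smaller than the first digit the next remainder is again \<open>\<rho> 1\<close>. The same deficit
  of one gives w p \<noteq> w 0.\<close>

lemma mp_periodic_of_remainders:
  fixes B :: real and \<rho> :: "nat \<Rightarrow> real"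
  assumes B: "B > 1" and p: "p \<ge> 1" and r0: "\<rho> 0 = 1"
    and int: "\<And>j. j < p \<Longrightarrow> B * \<rho> j - \<rho> (Suc j) \<in> \<int>"
    and last: "\<rho> p = 1 - 1 / B"
    and bd: "\<And>j. 1 \<le> j \<Longrightarrow> j \<le> p \<Longrightarrow> 0 < \<rho> j \<and> \<rho> j \<le> 1"
  shows "\<exists>p. mp_periodic (beta_exp_one B) 1 p"
proof -
  \<comment> \<open>After the initial 1 the values \<open>\<rho> 1\<close>, ...,
    \<open>\<rho> p\<close> are read cyclically; \<open>\<rho> 0\<close> never returns, which is the
    source of the preperiod 1.\<close>
  define r where "r n = (if n = 0 then 1 else \<rho> (Suc ((n - 1) mod p)))" for n
  define w where "w n = \<lfloor>B * r n - r (Suc n)\<rfloor>" for n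
  have step: "B * r n - r (Suc n) \<in> \<int>" for n
  proof (cases n)
    case 0
    then show ?thesis using int[of 0] p r0 by (simp add: r_def)
  next
    case (Suc k)
    show ?thesis
    proof (cases "Suc (k mod p) = p")
      case True
      then have "Suc k mod p = 0" by (simp add: mod_Suc)
      then have "B * r n - r (Suc n) = (B * \<rho> 0 - \<rho> (Suc 0)) - 1"
        using Suc True last r0 B by (simp add: r_def field_simps)
      then show ?thesis using int[of 0] p by simp
    next
      case False
      then have "Suc k mod p = Suc (k mod p)" by (simp add: mod_Suc)
      moreover have "Suc (k mod p) < p"
        using False p by (metis Suc_lessI mod_less_divisor less_eq_Suc_le One_nat_def)
      ultimately show ?thesis using Suc int[of "Suc (k mod p)"] by (simp add: r_def)
    qed
  qed
  have rec: "r (Suc n) = B * r n - w n" for n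
    using step[of n] by (simp add: w_def)
  have bd': "0 < r (Suc n) \<and> r (Suc n) \<le> 1" for n
    using bd[of "Suc (n mod p)"] p by (simp add: r_def Suc_leI)
  have eq: "beta_exp_one B = w"
    by (rule beta_exp_one_eqI[where r = r and w = w, OF B _ rec bd']) (simp add: r_def)
  have per: "r (Suc n + p) = r (Suc n)" for n by (simp add: r_def)
  have "periodic_from w 1 p"
    unfolding periodic_from_def
  proof (intro conjI allI impI p)
    fix n :: nat assume "1 \<le> n"
    then obtain k where "n = Suc k" by (cases n) auto
    then show "w (n + p) = w n" using per[of k] per[of "Suc k"] by (simp add: w_def)
  qed
  moreover have "w p \<noteq> w 0"
  proof
    assume "w p = w 0"
    moreover have "r p = 1 - 1 / B" using p last by (simp add: r_def)
    moreover have "r (Suc p) = r 1" using per[of 0] by simp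
    ultimately show False using rec[of p] rec[of 0] B by (simp add: r_def field_simps)
  qed
  ultimately show ?thesis using mp_periodic_oneI eq by simp
qed

text \<open>The tuple \<open>(c\<^sub>n)\<close> consists of the coefficients of \<open>h(x) (x\<^sup>4 - s x\<^sup>3 + r x\<^sup>2 - s x + 1)\<close>;
  the remainders of the expansion of one are \<open>c\<^sub>n - c\<^sub>n\<^sub>-\<^sub>1 / B\<close>, the coefficients of its product with \<open>x - 1 / B\<close>.
  Index \<open>0\<close> of \<open>h\<close> is padded by four zeros.\<close>

definition conv_coeff :: "real \<Rightarrow> real \<Rightarrow> int \<Rightarrow> int \<Rightarrow> int \<Rightarrow> int \<Rightarrow> int \<Rightarrow> real" where
  "conv_coeff s r e a b c d = e - s * a + r * b - s * c + d"

text \<open>The hypotheses \<open>i1\<close>, \<open>i2\<close>, \<open>i3\<close> say that (x^2 - t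
  x + 1)(x^4 - s x^3 + r x^2 - s x + 1) has integer coefficients: up to sign these are t + s, t s +
  r + 1 and t r + 2 s.\<close>

lemma mp_periodic_of_multiplier:
  fixes B s r :: real and h :: "nat \<Rightarrow> int"
  assumes B: "B > 1"
    and t: "t = B + 1 / B"
    and i1: "t + s \<in> \<int>" and i2: "t * s + r \<in> \<int>" and i3: "t * r + 2 * s \<in> \<int>"
    and h0: "\<And>i. i < 4 \<Longrightarrow> h i = 0" and h4: "h 4 = 1"
    and hd: "h (d + 4) = 1" and h_end: "\<And>i. i > d + 4 \<Longrightarrow> h i = 0"
  defines "c \<equiv> \<lambda>n. conv_coeff s r (h (n + 4)) (h (n + 3)) (h (n + 2)) (h (n + 1)) (h n)"
  assumes bd: "\<And>n. 1 \<le> n \<Longrightarrow> n \<le> d + 3 \<Longrightarrow>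
      c n = 1 \<or> (1 / B < c n \<and> c n \<le> 1)"
  shows "\<exists>p. mp_periodic (beta_exp_one B) 1 p"
proof -
  define p where "p = d + 5"
  \<comment> \<open>At n = p the general formula would give -1/B, because the product has ended.
    Adding 1 there, that is, lowering the last digit by one, brings the remainder back into (0,
    1].\<close>
  define \<rho> where "\<rho> n = (if n = 0 then 1 else if n = p then 1 - 1 / B else c n - c (n - 1) / B)" for n
  have c0: "c 0 = 1" using h0[of 0] h0[of 1] h0[of 2] h0[of 3] h4
    by (simp add: c_def conv_coeff_def numeral_eq_Suc)
  have clast: "c (d + 4) = 1"
    using hd h_end[of "d + 8"] h_end[of "d + 7"] h_end[of "d + 6"] h_end[of "d + 5"]
    by (simp add: c_def conv_coeff_def numeral_eq_Suc)
  have cend: "c (d + 5) = 0"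
    using h_end[of "d + 9"] h_end[of "d + 8"] h_end[of "d + 7"] h_end[of "d + 6"] h_end[of "d + 5"]
    by (simp add: c_def conv_coeff_def numeral_eq_Suc)
  \<comment> \<open>Up to sign this is a coefficient of the integer polynomial (x^2 - t x + 1) A(x)
    h(x); it is also the digit B \<rho> - \<rho>' away from both ends of the period.\<close>
  have key: "t * c (Suc n) - c n - c (Suc (Suc n)) \<in> \<int>" for n
  proof -
    obtain x y z where xyz: "t + s = of_int x" "t * s + r = of_int y" "t * r + 2 * s = of_int z"
      using i1 i2 i3 by (auto elim!: Ints_cases)
    have "t * c (Suc n) - c n - c (Suc (Suc n)) =
      - of_int (h (n + 6)) + (t + s) * of_int (h (n + 5)) - (t * s + r + 1) * of_int (h (n + 4))
      + (t * r + 2 * s) * of_int (h (n + 3)) - (t * s + r + 1) * of_int (h (n + 2))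
      + (t + s) * of_int (h (n + 1)) - of_int (h n)"
      by (simp add: c_def conv_coeff_def algebra_simps eval_nat_numeral)
    also have "\<dots> = of_int (- h (n + 6) + x * h (n + 5) - (y + 1) * h (n + 4) + z * h (n + 3)
      - (y + 1) * h (n + 2) + x * h (n + 1) - h n)"
      by (simp add: xyz)
    finally show ?thesis by (metis Ints_of_int)
  qed
  show ?thesis
  proof (rule mp_periodic_of_remainders[OF B, of p \<rho>])
    fix j assume j: "j < p"
    consider "j = 0" | n where "j = Suc n" "Suc n < d + 4" | "j = d + 4"
      using j by (cases j) (auto simp: p_def, fastforce)
    then show "B * \<rho> j - \<rho> (Suc j) \<in> \<int>"
    proof cases
      case 1
      have "B * \<rho> 0 - \<rho> (Suc 0) = (t + s) - of_int (h 5)"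
        using h0[of 1] h0[of 2] h0[of 3] h4 B t c0
        by (simp add: \<rho>_def p_def c_def conv_coeff_def numeral_eq_Suc)
      then show ?thesis using 1 i1 by simp
    next
      case 2
      then have "B * \<rho> j - \<rho> (Suc j) = t * c (Suc n) - c n - c (Suc (Suc n))"
        unfolding t using B by (simp add: \<rho>_def p_def field_simps)
      then show ?thesis using key by simp
    next
      case 3
      then have "B * \<rho> j - \<rho> (Suc j) = t * c (Suc (d + 3)) - c (d + 3) - c (Suc (Suc (d + 3))) - 1"
        unfolding t using B clast cend by (simp add: \<rho>_def p_def field_simps numeral_eq_Suc)
      then show ?thesis using key[of "d + 3"] by simp
    qed
  next
    have c01: "0 \<le> c n \<and> c n \<le> 1" if n4: "n \<le> d + 4" for n
    proof -
      consider "n = 0" | "1 \<le> n" "n \<le> d + 3" | "n = d + 4"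
        using n4 by linarith
      then show ?thesis
        using c0 clast bd[of n] B by cases (auto, smt (verit) divide_nonneg_pos)
    qed
    fix j assume j: "1 \<le> j" "j \<le> p"
    show "0 < \<rho> j \<and> \<rho> j \<le> 1"
    proof (cases "j = p")
      case True
      then show ?thesis using B j by (simp add: \<rho>_def)
    next
      case False
      then have le: "j \<le> d + 4" using j by (simp add: p_def)
      have c1: "0 \<le> c (j - 1) / B" "c (j - 1) / B \<le> 1 / B"
        using c01[of "j - 1"] le B by (auto simp: divide_right_mono)
      have "1 / B < c j" "c j \<le> 1"
        using bd[of j] j le clast B by (cases "j = d + 4"; force)+
      then show ?thesis using c1 False j by (simp add: \<rho>_def)
    qed
  qed (auto simp: p_def \<rho>_def)
qed

subsection \<open>Conjugates of powers of Salem numbers\<close>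

definition ratpoly :: "rat poly \<Rightarrow> complex \<Rightarrow> complex" where
  "ratpoly p z = poly (map_poly of_rat p) z"

definition intpoly :: "int poly \<Rightarrow> complex \<Rightarrow> complex" where
  "intpoly p z = poly (map_poly of_int p) z"

lemma ratpoly_pCons [simp]: "ratpoly (pCons a p) z = of_rat a + z * ratpoly p z"
  and ratpoly_0 [simp]: "ratpoly 0 z = 0"
  by (simp_all add: ratpoly_def map_poly_pCons)

lemma ratpoly_1 [simp]: "ratpoly 1 z = 1"
  by (simp add: one_pCons)

lemma intpoly_pCons [simp]: "intpoly (pCons a p) z = of_int a + z * intpoly p z"
  and intpoly_0 [simp]: "intpoly 0 z = 0"
  by (simp_all add: intpoly_def map_poly_pCons)

lemma ratpoly_add [simp]: "ratpoly (p + q) z = ratpoly p z + ratpoly q z"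
  by (induction p q rule: poly_induct2) (auto simp: of_rat_add algebra_simps)

lemma intpoly_add [simp]: "intpoly (p + q) z = intpoly p z + intpoly q z"
  by (induction p q rule: poly_induct2) (auto simp: algebra_simps)

lemma ratpoly_smult [simp]: "ratpoly (smult a p) z = of_rat a * ratpoly p z"
  by (induction p) (auto simp: of_rat_mult algebra_simps)

lemma intpoly_smult [simp]: "intpoly (smult a p) z = of_int a * intpoly p z"
  by (induction p) (auto simp: algebra_simps)

lemma ratpoly_mult [simp]: "ratpoly (p * q) z = ratpoly p z * ratpoly q z"
  by (induction p) (auto simp: algebra_simps)

lemma intpoly_mult [simp]: "intpoly (p * q) z = intpoly p z * intpoly q z"
  by (induction p) (auto simp: algebra_simps)

lemma intpoly_monom: "intpoly (monom 1 n) z = z ^ n"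
  by (simp add: intpoly_def map_poly_monom poly_monom)

lemma ratpoly_of_int: "ratpoly (map_poly of_int p) z = intpoly p z"
  by (induction p) (auto simp: map_poly_pCons)

text \<open>A rational polynomial M of least degree vanishing at z divides every polynomial
  vanishing there. It is not a unit, so the irreducible P, a multiple of M, divides M in
  turn.\<close>

lemma irreducible_dvd_if_common_root:
  assumes irr: "irreducible P" and P: "ratpoly P z = 0" and G: "ratpoly G z = 0"
  shows "P dvd G"
proof (cases "P = 0")
  case False
  define M where "M = (ARG_MIN degree M. M \<noteq> 0 \<and> ratpoly M z = 0)"
  have M: "M \<noteq> 0" "ratpoly M z = 0"
    using arg_min_natI[of "\<lambda>M. M \<noteq> 0 \<and> ratpoly M z = 0" P degree] False P unfolding M_def by auto
  have dvd: "M dvd F" if "ratpoly F z = 0" for F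
  proof (rule ccontr)
    assume "\<not> M dvd F"
    then have "F mod M \<noteq> 0" by (simp add: mod_eq_0_iff_dvd)
    moreover have "ratpoly (F div M * M + F mod M) z = 0" using that by simp
    then have "ratpoly (F mod M) z = 0" unfolding ratpoly_add ratpoly_mult M(2) by simp
    ultimately have "degree M \<le> degree (F mod M)"
      unfolding M_def by (intro arg_min_nat_le) auto
    then show False using degree_mod_less[OF M(1), of F] \<open>F mod M \<noteq> 0\<close> by simp
  qed
  have "\<not> is_unit M"
  proof
    assume "is_unit M"
    then obtain V where "1 = M * V" by (elim dvdE)
    then have "ratpoly 1 z = ratpoly (M * V) z" by simp
    then show False unfolding ratpoly_mult M(2) by simp
  qed
  then have "P dvd M" using irreducibleD'[OF irr dvd[OF P]] by blast
  then show ?thesis using dvd[OF G] by (rule dvd_trans)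
qed (use irr in simp)

text \<open>This replaces a field automorphism taking z to y: one integer relation is carried over
  at a time.\<close>

lemma conjugate_root:
  assumes irr: "irreducible (map_poly rat_of_int P)"
    and "intpoly P z = 0" "intpoly P y = 0" "intpoly G z = 0"
  shows "intpoly G y = 0"
proof -
  have "map_poly rat_of_int P dvd map_poly rat_of_int G"
    by (rule irreducible_dvd_if_common_root[OF irr]) (use assms in \<open>simp_all add: ratpoly_of_int\<close>)
  then obtain H where "map_poly rat_of_int G = map_poly rat_of_int P * H" by (elim dvdE)
  then show ?thesis using assms(3) by (metis mult_zero_left ratpoly_mult ratpoly_of_int)
qed

text \<open>Applied to polynomials of degree at most 5, this forces the coefficients of the sextic
  to be palindromic and excludes a double root of its trace cubic.\<close>

lemma low_degree_root:
  assumes irr: "irreducible (map_poly rat_of_int P)"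
    and "intpoly P z = 0" "intpoly G z = 0" "degree G < degree P"
  shows "G = 0"
proof (rule ccontr)
  assume "G \<noteq> 0"
  have "map_poly rat_of_int P dvd map_poly rat_of_int G"
    by (rule irreducible_dvd_if_common_root[OF irr]) (use assms in \<open>simp_all add: ratpoly_of_int\<close>)
  moreover have "map_poly rat_of_int G \<noteq> 0"
    using \<open>G \<noteq> 0\<close> by (simp add: map_poly_eq_0_iff)
  moreover have "degree (map_poly rat_of_int F) = degree F" for F
    by (rule degree_map_poly) simp
  ultimately show False using assms(4) by (metis dvd_imp_degree_le not_le)
qed

text \<open>Functions \<open>x + 1 / x \<mapsto> F (x + 1 / x)\<close> with \<open>F\<close> an integer polynomial become integer polynomials in \<open>x\<close>
  after multiplication by a power of \<open>x\<close>.\<close>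

inductive intpoly_fun :: "(complex \<Rightarrow> complex) \<Rightarrow> bool" where
  ident: "intpoly_fun (\<lambda>x. x)"
| const: "intpoly_fun (\<lambda>_. of_int k)"
| add: "intpoly_fun f \<Longrightarrow> intpoly_fun g \<Longrightarrow> intpoly_fun (\<lambda>x. f x + g x)"
| mult: "intpoly_fun f \<Longrightarrow> intpoly_fun g \<Longrightarrow> intpoly_fun (\<lambda>x. f x * g x)"

lemma intpoly_fun_diff: "intpoly_fun f \<Longrightarrow> intpoly_fun g \<Longrightarrow> intpoly_fun (\<lambda>x. f x - g x)"
  using intpoly_fun.add[OF _ intpoly_fun.mult[OF intpoly_fun.const[of "-1"]], of f g] by simp

lemma intpoly_fun_laurent:
  assumes "intpoly_fun f"
  obtains G n where "\<And>x. x \<noteq> 0 \<Longrightarrow> intpoly G x = x ^ n * f (x + 1 / x)"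
proof -
  have "\<exists>G n. \<forall>x. x \<noteq> 0 \<longrightarrow> intpoly G x = x ^ n * f (x + 1 / x)"
    using assms
  proof (induction rule: intpoly_fun.induct)
    case ident
    show ?case
      by (rule exI[of _ "[:1, 0, 1:]"], rule exI[of _ 1]) (simp add: distrib_left)
  next
    case (const k)
    show ?case
      by (rule exI[of _ "[:k:]"], rule exI[of _ 0]) simp
  next
    case (add f g)
    from add.IH(1) obtain G n where G: "\<forall>x. x \<noteq> 0 \<longrightarrow> intpoly G x = x ^ n * f (x + 1 / x)"
      by (elim exE)
    from add.IH(2) obtain H l where H: "\<forall>x. x \<noteq> 0 \<longrightarrow> intpoly H x = x ^ l * g (x + 1 / x)"
      by (elim exE)
    show ?case
      by (rule exI[of _ "monom 1 l * G + monom 1 n * H"], rule exI[of _ "n + l"])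
        (simp add: G H intpoly_monom power_add distrib_left)
  next
    case (mult f g)
    from mult.IH(1) obtain G n where G: "\<forall>x. x \<noteq> 0 \<longrightarrow> intpoly G x = x ^ n * f (x + 1 / x)"
      by (elim exE)
    from mult.IH(2) obtain H l where H: "\<forall>x. x \<noteq> 0 \<longrightarrow> intpoly H x = x ^ l * g (x + 1 / x)"
      by (elim exE)
    show ?case
      by (rule exI[of _ "G * H"], rule exI[of _ "n + l"]) (simp add: G H power_add)
  qed
  then show ?thesis by (elim exE) (rule that, blast)
qed

lemma quadratic_roots:
  fixes p q :: complex
  obtains x y where "x + y = p" "x * y = q"
proof
  show "(p + csqrt (p\<^sup>2 - 4 * q)) / 2 + (p - csqrt (p\<^sup>2 - 4 * q)) / 2 = p" by (simp add: field_simps)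
  have "(p + csqrt (p\<^sup>2 - 4 * q)) / 2 * ((p - csqrt (p\<^sup>2 - 4 * q)) / 2) = (p\<^sup>2 - (csqrt (p\<^sup>2 - 4 * q))\<^sup>2) / 4"
    by (simp add: field_simps power2_eq_square)
  then show "(p + csqrt (p\<^sup>2 - 4 * q)) / 2 * ((p - csqrt (p\<^sup>2 - 4 * q)) / 2) = q" by simp
qed

text \<open>Horner form is the shape in which evaluation of \<open>pCons\<close> lists comes out.
  Writing y for 1/x keeps hypothesis and claim polynomial, so \<open>algebra\<close> can decide the
  identity; the next two lemmas follow the same pattern.\<close>

lemma sextic_reversal:
  fixes x y :: complex
  assumes "x * y = 1"
  shows "x ^ 6 * (a0 + y * (a1 + y * (a2 + y * (a3 + y * (a4 + y * (a5 + y))))))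
    = 1 + x * (a5 + x * (a4 + x * (a3 + x * (a2 + x * (a1 + x * a0)))))"
  using assms by algebra

lemma palindromic_sextic:
  fixes x y :: complex
  assumes "x * y = 1"
  shows "1 + x * (a + x * (b + x * (c + x * (b + x * (a + x)))))
    = x ^ 3 * ((x + y) ^ 3 + a * (x + y)\<^sup>2 + (b - 3) * (x + y) + (c - 2 * a))"
  using assms by algebra

text \<open>The last factor is the derivative, at x + y, of the cubic in
  \<open>palindromic_sextic\<close>. A double root of the cubic would thus make a quartic vanish at
  a root of the sextic.\<close>

lemma palindromic_quartic:
  fixes x y :: complex
  assumes "x * y = 1"
  shows "3 + x * (2 * a + x * (b + 3 + x * (2 * a + x * 3)))
    = x\<^sup>2 * (3 * (x + y)\<^sup>2 + 2 * a * (x + y) + (b - 3))"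
  using assms by algebra
text \<open>A palindromic sextic is x^3 times a cubic in x + 1/x. The integers \<open>e1\<close>,
  \<open>e2\<close>, \<open>e3\<close> are the elementary symmetric functions of its roots; the last
  conclusion is conjugation from a unimodular trace to the trace of \<beta>.\<close>

lemma salem6_trace_cubic:
  assumes "salem_number_deg 6 \<beta>"
  defines "T \<equiv> complex_of_real (\<beta> + 1 / \<beta>)"
  obtains \<theta> \<phi> :: real and e1 e2 e3 :: int where
    "T + complex_of_real (2 * cos \<theta>) + complex_of_real (2 * cos \<phi>) = of_int e1"
    "T * complex_of_real (2 * cos \<theta>) + T * complex_of_real (2 * cos \<phi>)
       + complex_of_real (2 * cos \<theta>) * complex_of_real (2 * cos \<phi>) = of_int e2"
    "T * complex_of_real (2 * cos \<theta>) * complex_of_real (2 * cos \<phi>) = of_int e3"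
    "\<And>F. intpoly_fun F \<Longrightarrow>
       F (complex_of_real (2 * cos \<theta>)) = 0 \<or> F (complex_of_real (2 * cos \<phi>)) = 0 \<Longrightarrow> F T = 0"
proof -
  from assms(1) obtain P where \<beta>: "\<beta> > 1" and P: "lead_coeff P = 1" "degree P = 6"
    and irr: "irreducible (map_poly rat_of_int P)"
    and root: "poly (map_poly real_of_int P) \<beta> = 0"
    and le1: "\<And>z. intpoly P z = 0 \<Longrightarrow> z \<noteq> complex_of_real \<beta> \<Longrightarrow> cmod z \<le> 1"
    and unit: "\<exists>z. intpoly P z = 0 \<and> cmod z = 1"
    unfolding salem_number_deg_def intpoly_def by blast
  define a where "a i = coeff P i" for i
  have Peq: "P = [:a 0, a 1, a 2, a 3, a 4, a 5, 1:]"
  proof (rule poly_eqI)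
    fix n
    show "coeff P n = coeff [:a 0, a 1, a 2, a 3, a 4, a 5, 1:] n"
    proof (cases "n \<le> 6")
      case True
      then have "n \<in> {0, 1, 2, 3, 4, 5, 6}" by auto
      then show ?thesis using P by (auto simp: a_def eval_nat_numeral)
    next
      case False
      moreover have "degree [:a 0, a 1, a 2, a 3, a 4, a 5, 1:] = 6" by simp
      ultimately show ?thesis using P(2) by (simp only: coeff_eq_0 not_le)
    qed
  qed
  have rootB: "intpoly P (of_real \<beta>) = 0"
  proof -
    have "intpoly F (of_real x) = of_real (poly (map_poly real_of_int F) x)" for F x
      by (induction F) (auto simp: map_poly_pCons)
    then show ?thesis using root by simp
  qed
  have irr_low: "G = 0" if "intpoly P z = 0" "intpoly G z = 0" "degree G < 6" for G z
    using low_degree_root[OF irr that(1,2)] that(3) P(2) by simp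
  from unit obtain z0 where z0: "intpoly P z0 = 0" "cmod z0 = 1" by blast
  have z0n: "z0 \<noteq> 0" using z0(2) by auto
  have "intpoly P (cnj z0) = cnj (intpoly P z0)" unfolding Peq by simp
  moreover have "cnj z0 = 1 / z0"
    using z0(2) z0n complex_norm_square[of z0] by (simp add: field_simps)
  ultimately have inv0: "intpoly P (1 / z0) = 0" using z0(1) by simp
  \<comment> \<open>The reversed polynomial minus \<open>a 0\<close> times P: the terms of degree 6
    cancel. It vanishes at z0 because 1/z0, the complex conjugate of z0, is a root of P as
    well.\<close>
  define H where "H = [:1 - a 0 * a 0, a 5 - a 0 * a 1, a 4 - a 0 * a 2, a 3 - a 0 * a 3, a 2 - a 0 * a 4, a 1 - a 0 * a 5:]"
  have "intpoly H z0 = z0 ^ 6 * intpoly P (1 / z0) - of_int (a 0) * intpoly P z0"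
  proof -
    have "z0 * (1 / z0) = 1" using z0n by simp
    note rev = sextic_reversal[OF this, of "of_int (a 0)" "of_int (a 1)" "of_int (a 2)" "of_int (a 3)" "of_int (a 4)" "of_int (a 5)"]
    have "z0 ^ 6 * intpoly P (1 / z0) = intpoly [:1, a 5, a 4, a 3, a 2, a 1, a 0:] z0"
      unfolding Peq using rev by simp
    then show ?thesis unfolding H_def Peq by (simp add: algebra_simps)
  qed
  then have "intpoly H z0 = 0" using z0(1) inv0 by simp
  moreover have "degree H < 6"
  proof -
    have *: "degree (pCons c p) \<le> Suc n" if "degree p \<le> n" for c :: int and p n
      using degree_pCons_le[of c p] that by simp
    have "degree H \<le> Suc (Suc (Suc (Suc (Suc 0))))"
      unfolding H_def by (intro *) simp
    then show ?thesis by simp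
  qed
  ultimately have "H = 0" using irr_low z0(1) by blast
  then have pal: "1 = a 0 * a 0" "a 5 = a 0 * a 1" "a 4 = a 0 * a 2" "a 3 = a 0 * a 3"
    unfolding H_def pCons_eq_0_iff right_minus_eq by blast+
  \<comment> \<open>The other sign would make P antipalindromic, with 1 as a root.\<close>
  have "a 0 = 1"
  proof (rule ccontr)
    assume "a 0 \<noteq> 1"
    with pal(1) have "a 0 = -1" by (metis minus_one_mult_self mult_cancel_left2 mult_minus1 square_eq_1_iff)
    with pal have "intpoly P 1 = 0" unfolding Peq by simp
    moreover have "intpoly [:-1, 1:] 1 = 0" by simp
    ultimately show False using irr_low[of 1 "[:-1, 1:]"] by simp
  qed
  with pal have Pp: "P = [:1, a 1, a 2, a 3, a 2, a 1, 1:]" using Peq by simp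
  define C where "C y = y ^ 3 + of_int (a 1) * y\<^sup>2 + of_int (a 2 - 3) * y + of_int (a 3 - 2 * a 1)" for y :: complex
  have PC: "intpoly P x = x ^ 3 * C (x + 1 / x)" if "x \<noteq> 0" for x
    using palindromic_sextic[of x "1 / x" "of_int (a 1)" "of_int (a 2)" "of_int (a 3)"] that
    unfolding Pp C_def by simp
  have TB: "T = of_real \<beta> + 1 / of_real \<beta>" by (simp add: T_def)
  have bn: "complex_of_real \<beta> \<noteq> 0" using \<beta> by simp
  have CT: "C T = 0" using PC[OF bn] rootB bn unfolding TB by simp
  obtain U V where UV: "U + V = - (of_int (a 1) + T)" "U * V = of_int (a 2 - 3) + (of_int (a 1) + T) * T"
    by (rule quadratic_roots)
  have fac: "C w = (w - T) * ((w - U) * (w - V))" for w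
  proof -
    have eq: "(w - U) * (w - V) = w\<^sup>2 - (U + V) * w + U * V" by (simp add: algebra_simps power2_eq_square)
    have "(w - T) * ((w - U) * (w - V)) = C w - C T"
      unfolding eq UV C_def by (simp add: algebra_simps power2_eq_square power3_eq_cube)
    then show ?thesis using CT by simp
  qed
  \<comment> \<open>If W = T, then T is a double root of the trace cubic, and the quartic obtained
    from the derivative vanishes at \<beta> although its degree is below 6.\<close>
  have distinct: "W \<noteq> T" if "W + W' = - (of_int (a 1) + T)" "W * W' = of_int (a 2 - 3) + (of_int (a 1) + T) * T" for W W'
  proof
    assume "W = T"
    with that(1) have W': "W' = - (of_int (a 1) + T) - T" by (metis add_diff_cancel_left')
    have z: "3 * T\<^sup>2 + 2 * of_int (a 1) * T + of_int (a 2 - 3) = 0"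
      using that(2) unfolding W' \<open>W = T\<close> by (simp add: algebra_simps power2_eq_square)
    have "intpoly [:3, 2 * a 1, a 2 + 3, 2 * a 1, 3:] (of_real \<beta>)
        = (of_real \<beta>)\<^sup>2 * (3 * T\<^sup>2 + 2 * of_int (a 1) * T + of_int (a 2 - 3))"
      using palindromic_quartic[of "of_real \<beta>" "1 / of_real \<beta>" "of_int (a 1)" "of_int (a 2)"] bn
      unfolding TB by simp
    then show False using irr_low[OF rootB, of "[:3, 2 * a 1, a 2 + 3, 2 * a 1, 3:]"] z by simp
  qed
  have circle: "\<exists>\<theta> z. W = of_real (2 * cos \<theta>) \<and> intpoly P z = 0 \<and> z \<noteq> 0 \<and> W = z + 1 / z"
    if W: "C W = 0" "W \<noteq> T" for W
  proof -
    obtain z z' where zz: "z + z' = W" "z * z' = 1" by (rule quadratic_roots)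
    have zn: "z \<noteq> 0" using zz(2) by auto
    then have "z' = 1 / z" using zz(2) by (simp add: eq_divide_eq mult.commute)
    with zz have Wz: "W = z + 1 / z" by simp
    have P0: "intpoly P z = 0" "intpoly P (1 / z) = 0"
      using PC[OF zn] PC[of "1 / z"] zn W(1) Wz by (simp_all add: add.commute)
    \<comment> \<open>As W differs from T, neither z nor 1/z is \<beta>. The Salem bound therefore
      applies to both and forces modulus exactly 1.\<close>
    have "z = 1 / of_real \<beta>" if "1 / z = of_real \<beta>"
      unfolding that[symmetric] by simp
    then have "z \<noteq> of_real \<beta>" "1 / z \<noteq> of_real \<beta>"
      using W(2) Wz TB by (auto simp: add.commute)
    with le1 P0 have "cmod z \<le> 1" "cmod (1 / z) \<le> 1" by blast+
    then have "cmod z = 1" using zn by (simp add: norm_divide divide_simps split: if_splits)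
    then obtain \<theta> where \<theta>: "z = cis \<theta>"      by (metis mult_1 of_real_1 rcis_cmod_Arg rcis_def)
    then have "W = of_real (2 * cos \<theta>)"      unfolding Wz \<theta> by (simp add: divide_inverse complex_eq_iff flip: cis_inverse)
    then show ?thesis using P0(1) zn Wz by blast
  qed
  have CUV: "C U = 0" "C V = 0" by (simp_all add: fac)
  have "U \<noteq> T" "V \<noteq> T" using distinct[OF UV] distinct[of V U] UV by (auto simp: add.commute mult.commute)
  with circle CUV obtain \<theta> z \<phi> y where U: "U = of_real (2 * cos \<theta>)" "intpoly P z = 0" "z \<noteq> 0" "U = z + 1 / z"
    and V: "V = of_real (2 * cos \<phi>)" "intpoly P y = 0" "y \<noteq> 0" "V = y + 1 / y" by metis
  have trans: "F T = 0" if F: "intpoly_fun F" and W: "F W = 0" "intpoly P x = 0" "x \<noteq> 0" "W = x + 1 / x" for F W x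
  proof -
    obtain G n where G: "\<And>x. x \<noteq> 0 \<Longrightarrow> intpoly G x = x ^ n * F (x + 1 / x)"
      using intpoly_fun_laurent[OF F] by blast
    have "intpoly G x = 0" using G[OF W(3)] W by simp
    then have "intpoly G (of_real \<beta>) = 0" using conjugate_root[OF irr W(2) rootB] by blast
    then show ?thesis using G[OF bn] bn TB by simp
  qed
  show ?thesis
  proof (rule that[of \<theta> \<phi> "- a 1" "a 2 - 3" "2 * a 1 - a 3"])
    show "T + of_real (2 * cos \<theta>) + of_real (2 * cos \<phi>) = of_int (- a 1)"
      unfolding U(1)[symmetric] V(1)[symmetric] add.assoc UV(1) by simp
    have "T * U + T * V + U * V = T * (U + V) + U * V" by (simp only: distrib_left)
    also have "\<dots> = of_int (a 2 - 3)" unfolding UV by (simp add: algebra_simps)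
    finally show "T * of_real (2 * cos \<theta>) + T * of_real (2 * cos \<phi>) + of_real (2 * cos \<theta>) * of_real (2 * cos \<phi>) = of_int (a 2 - 3)"
      unfolding U(1)[symmetric] V(1)[symmetric] .
    have "T * U * V = - C 0" unfolding fac by simp
    also have "\<dots> = of_int (2 * a 1 - a 3)" by (simp add: C_def)
    finally show "T * of_real (2 * cos \<theta>) * of_real (2 * cos \<phi>) = of_int (2 * a 1 - a 3)"
      unfolding U(1)[symmetric] V(1)[symmetric] .
    show "F T = 0" if "intpoly_fun F" "F (of_real (2 * cos \<theta>)) = 0 \<or> F (of_real (2 * cos \<phi>)) = 0" for F
    proof -
      from that(2) consider "F U = 0" | "F V = 0" unfolding U(1) V(1) by blast
      then show ?thesis
        by cases (erule trans[OF that(1) _ U(2-4)], erule trans[OF that(1) _ V(2-4)])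
    qed
  qed
qed

section \<open>Traces of powers and relations between cosines\<close>

fun dickson :: "nat \<Rightarrow> complex \<Rightarrow> complex" where
  "dickson 0 x = 2"
| "dickson (Suc 0) x = x"
| "dickson (Suc (Suc n)) x = x * dickson (Suc n) x - dickson n x"

lemma dickson_plus_inverse:
  assumes "z \<noteq> 0"
  shows "dickson n (z + 1 / z) = z ^ n + 1 / z ^ n"
proof -
  define y where "y = 1 / z"
  have zy: "z * y = 1" using assms by (simp add: y_def)
  have step: "(z + y) * (z * a + y * b) - (a + b) = z * (z * a) + y * (y * b)" for a b
    using zy by algebra
  have "dickson n (z + y) = z ^ n + y ^ n"
    by (induction n rule: induct_nat_012) (simp_all add: step)
  then show ?thesis by (simp add: y_def power_one_over)
qed

lemma dickson_cos: "dickson n (of_real (2 * cos \<theta>)) = of_real (2 * cos (real n * \<theta>))"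
proof (induction n "complex_of_real (2 * cos \<theta>)" rule: dickson.induct)
  case (3 n)
  have "real (Suc (Suc n)) * \<theta> = real (Suc n) * \<theta> + \<theta>" "real n * \<theta> = real (Suc n) * \<theta> - \<theta>"
    by (simp_all add: algebra_simps)
  then have "2 * cos (real (Suc (Suc n)) * \<theta>) = 2 * cos \<theta> * (2 * cos (real (Suc n) * \<theta>)) - 2 * cos (real n * \<theta>)"
    by (simp only: cos_add cos_diff) simp
  then show ?case unfolding dickson.simps 3 of_real_mult[symmetric] of_real_diff[symmetric] by (simp only:)
qed auto

lemma intpoly_fun_dickson: "intpoly_fun (dickson n)"
proof (induction n rule: induct_nat_012)
  case 0
  show ?case using intpoly_fun.const[of 2] by (simp add: fun_eq_iff[of "dickson 0"] ext[of "dickson 0" "\<lambda>_. 2"])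
next
  case 1
  have "dickson (Suc 0) = (\<lambda>x. x)" by (simp add: fun_eq_iff)
  then show ?case by (simp add: intpoly_fun.ident)
next
  case (ge2 n)
  have "dickson (Suc (Suc n)) = (\<lambda>x. x * dickson (Suc n) x - dickson n x)" by (simp add: fun_eq_iff)
  then show ?case using ge2 by (simp add: intpoly_fun_diff intpoly_fun.ident intpoly_fun.mult)
qed

text \<open>Reduction modulo the trace cubic. One integer quadratic represents the nth trace at all
  three roots simultaneously, so explicit formulas for quadratics cover every n.\<close>

lemma dickson_mod_cubic:
  fixes e1 e2 e3 :: int
  obtains a b c :: int where
    "\<And>x. x ^ 3 = of_int e1 * x\<^sup>2 - of_int e2 * x + of_int e3 \<Longrightarrow>
      dickson n x = of_int a + of_int b * x + of_int c * x\<^sup>2"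
proof -
  have step: "x * (a' + b' * x + c' * x\<^sup>2) - (a + b * x + c * x\<^sup>2) = (c' * r - a) + (a' - c' * q - b) * x + (b' + c' * p - c) * x\<^sup>2"
    if "x ^ 3 = p * x\<^sup>2 - q * x + r" for x a b c a' b' c' p q r :: complex
    using that by algebra
  define Q where "Q n a b c \<longleftrightarrow> (\<forall>x. x ^ 3 = of_int e1 * x\<^sup>2 - of_int e2 * x + of_int e3 \<longrightarrow>
      dickson n x = of_int a + of_int b * x + of_int c * x\<^sup>2)" for n and a b c :: int
  have "\<exists>a b c. Q n a b c" for n
  proof (induction n rule: induct_nat_012)
    case 0
    have "Q 0 2 0 0" by (simp add: Q_def)
    then show ?case by blast
  next
    case 1
    have "Q (Suc 0) 0 1 0" by (simp add: Q_def)
    then show ?case by blast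
  next
    case (ge2 n)
    then obtain a b c a' b' c' where "Q n a b c" "Q (Suc n) a' b' c'" by blast
    then have "Q (Suc (Suc n)) (c' * e3 - a) (a' - c' * e2 - b) (b' + c' * e1 - c)"
      unfolding Q_def by (simp add: step)
    then show ?case by blast
  qed
  then show ?thesis using that unfolding Q_def by blast
qed

lemma cubic_root_of_symmetric:
  fixes x y z :: complex
  assumes "x + y + z = e1" "x * y + x * z + y * z = e2" "x * y * z = e3"
  shows "x ^ 3 = e1 * x\<^sup>2 - e2 * x + e3"
  unfolding assms[symmetric] by algebra

text \<open>These identities stand in for the fundamental theorem on symmetric polynomials: with
  integer data the right-hand sides are visibly integers.\<close>

lemma symmetric_quadratic_values:
  fixes x y z a b c e1 e2 e3 :: complex
  assumes e: "x + y + z = e1" "x * y + x * z + y * z = e2" "x * y * z = e3"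
  defines "f \<equiv> \<lambda>x. a + b * x + c * x\<^sup>2"
  shows "f x + f y + f z = 3 * a + b * e1 + c * (e1\<^sup>2 - 2 * e2)"
    and "f x * f y + f x * f z + f y * f z = 3 * a\<^sup>2 + 2 * a * b * e1 + 2 * a * c * (e1\<^sup>2 - 2 * e2)
      + b\<^sup>2 * e2 + b * c * (e1 * e2 - 3 * e3) + c\<^sup>2 * (e2\<^sup>2 - 2 * e1 * e3)"
    and "f x * f y * f z = a ^ 3 + a\<^sup>2 * b * e1 + a\<^sup>2 * c * (e1\<^sup>2 - 2 * e2) + a * b\<^sup>2 * e2
      + a * b * c * (e1 * e2 - 3 * e3) + a * c\<^sup>2 * (e2\<^sup>2 - 2 * e1 * e3) + b ^ 3 * e3
      + b\<^sup>2 * c * (e1 * e3) + b * c\<^sup>2 * (e2 * e3) + c ^ 3 * e3\<^sup>2"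
  unfolding f_def e[symmetric] by algebra+

text \<open>The equality reads D_k(U) = D_l(V) for the Dickson polynomials. The product of D_k(x) -
  D_l(y) over the two roots y other than x is an integer polynomial in x alone. It vanishes at U,
  hence at T, so D_k(T) equals twice a cosine, whereas D_k(T) > 2.\<close>

lemma no_cosine_relation:
  fixes \<beta> \<theta> \<phi> :: real and e1 e2 e3 :: int
  defines "T \<equiv> complex_of_real (\<beta> + 1 / \<beta>)"
    and "U \<equiv> complex_of_real (2 * cos \<theta>)" and "V \<equiv> complex_of_real (2 * cos \<phi>)"
  assumes \<beta>: "\<beta> > 1"
    and e: "T + U + V = of_int e1" "T * U + T * V + U * V = of_int e2" "T * U * V = of_int e3"
    and trans: "\<And>F. intpoly_fun F \<Longrightarrow> F U = 0 \<or> F V = 0 \<Longrightarrow> F T = 0"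
    and kl: "k > 0 \<or> l > 0"
  shows "cos (real k * \<theta>) \<noteq> cos (real l * \<phi>)"
proof
  assume eq: "cos (real k * \<theta>) = cos (real l * \<phi>)"
  have T: "dickson n T = of_real (\<beta> ^ n + 1 / \<beta> ^ n)" for n
    using dickson_plus_inverse[of "of_real \<beta>" n] \<beta> by (simp add: T_def)
  have big: "\<beta> ^ n + 1 / \<beta> ^ n > 2" if "n > 0" for n
  proof -
    have "\<beta> ^ n > 1" using \<beta> that by (rule one_less_power)
    then have "0 < (\<beta> ^ n - 1)\<^sup>2 / \<beta> ^ n" by simp
    also have "\<dots> = \<beta> ^ n + 1 / \<beta> ^ n - 2"
      using \<open>\<beta> ^ n > 1\<close> \<beta> by (simp add: power2_diff add_divide_distrib diff_divide_distrib) (simp add: power2_eq_square)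
    finally show ?thesis by simp
  qed
  have ne: "dickson n T \<noteq> of_real (2 * cos x)" if "n > 0" for n x
    using big[OF that] cos_le_one[of x] unfolding T of_real_eq_iff by linarith
  have D: "dickson k U = dickson l V" unfolding U_def V_def dickson_cos eq ..
  show False
  proof (cases "k > 0")
    case True
    obtain a b c where abc: "\<And>x. x ^ 3 = of_int e1 * x\<^sup>2 - of_int e2 * x + of_int e3 \<Longrightarrow>
      dickson l x = of_int a + of_int b * x + of_int c * x\<^sup>2"
      using dickson_mod_cubic by blast
    have l: "dickson l T = of_int a + of_int b * T + of_int c * T\<^sup>2"
      "dickson l U = of_int a + of_int b * U + of_int c * U\<^sup>2"
      "dickson l V = of_int a + of_int b * V + of_int c * V\<^sup>2"
      using cubic_root_of_symmetric[of T U V] cubic_root_of_symmetric[of U V T] cubic_root_of_symmetric[of V T U] e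
      by (intro abc; simp add: ac_simps)+
    \<comment> \<open>\<open>S x\<close> and \<open>R x\<close> are the sum and the product of the
      two roots other than x. They are built from sums, products and integer constants so that the
      introduction rules of \<open>intpoly_fun\<close> apply.\<close>
    define S where "S x = of_int e1 + of_int (- 1) * x" for x :: complex
    define R where "R x = of_int e2 + of_int (- 1) * (x * S x)" for x
    \<comment> \<open>With f the quadratic that represents D_l, this is (D_k(x) - f y)(D_k(x) - f
      z), expanded through f y + f z and f y * f z in terms of \<open>S x\<close> and
      \<open>R x\<close>.\<close>
    define F where "F x = (dickson k x * dickson k x - dickson k x * (of_int (2 * a) + of_int b * S x + of_int c * (S x * S x - of_int 2 * R x)))
      + (of_int (a * a) + of_int (a * b) * S x + of_int (a * c) * (S x * S x - of_int 2 * R x)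
        + of_int (b * b) * R x + of_int (b * c) * (R x * S x) + of_int (c * c) * (R x * R x))" for x
    have S: "intpoly_fun S" unfolding S_def by (intro intpoly_fun.intros)
    have R: "intpoly_fun R" unfolding R_def by (intro intpoly_fun.intros S)
    have F: "intpoly_fun F" unfolding F_def by (intro intpoly_fun.intros intpoly_fun_diff intpoly_fun_dickson S R)
    have prod: "F x = (dickson k x - (of_int a + of_int b * y + of_int c * y\<^sup>2)) * (dickson k x - (of_int a + of_int b * z + of_int c * z\<^sup>2))"
      if "x + y + z = of_int e1" "x * y + x * z + y * z = of_int e2" for x y z
    proof -
      have SR: "S x = y + z" "R x = y * z" unfolding S_def R_def that[symmetric] by (simp_all add: algebra_simps)
      show ?thesis unfolding F_def SR by (simp add: algebra_simps power2_eq_square)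
    qed
    have "F U = 0" using prod[of U T V] e D l by (simp add: ac_simps)
    then have "F T = 0" using trans F by blast
    then have "dickson k T = dickson l U \<or> dickson k T = dickson l V"
      using prod[OF e(1,2)] l by auto
    then show False using ne[OF True] unfolding U_def V_def dickson_cos by blast
  next
    case False
    \<comment> \<open>For k = 0 the relation involves V only and can be conjugated directly, to
      D_l(T) = 2.\<close>
    with kl D have "l > 0" "dickson l V = 2" by auto
    moreover have "intpoly_fun (\<lambda>x. dickson l x - of_int 2)" by (intro intpoly_fun_diff intpoly_fun_dickson intpoly_fun.const)
    ultimately have "dickson l T = of_real (2 * cos 0)" using trans[of "\<lambda>x. dickson l x - of_int 2"] by simp
    then show False using ne[OF \<open>l > 0\<close>] by blast
  qed
qed

text \<open>The three integers are the inputs of \<open>mp_periodic_of_multiplier\<close> for B =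
  \<open>\<beta> ^ m\<close>, s = u + v and r = 2 + u v. The first conclusion supplies the
  independence for equidistribution.\<close>

lemma salem6_power_traces:
  assumes "salem_number_deg 6 \<beta>"
  obtains \<theta> \<phi> :: real where
    "\<And>k l :: nat. k > 0 \<or> l > 0 \<Longrightarrow> cos (real k * \<theta>) \<noteq> cos (real l * \<phi>)"
    "\<And>m t u v. t = \<beta> ^ m + 1 / \<beta> ^ m \<Longrightarrow> u = 2 * cos (real m * \<theta>) \<Longrightarrow> v = 2 * cos (real m * \<phi>) \<Longrightarrow>
      t + (u + v) \<in> \<int> \<and> t * (u + v) + (2 + u * v) \<in> \<int> \<and> t * (2 + u * v) + 2 * (u + v) \<in> \<int>"
proof -
  have \<beta>: "\<beta> > 1" using assms by (simp add: salem_number_deg_def)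
  from salem6_trace_cubic[OF assms] obtain \<theta> \<phi> e1 e2 e3 where e:
    "complex_of_real (\<beta> + 1 / \<beta>) + complex_of_real (2 * cos \<theta>) + complex_of_real (2 * cos \<phi>) = of_int e1"
    "complex_of_real (\<beta> + 1 / \<beta>) * complex_of_real (2 * cos \<theta>) + complex_of_real (\<beta> + 1 / \<beta>) * complex_of_real (2 * cos \<phi>)
       + complex_of_real (2 * cos \<theta>) * complex_of_real (2 * cos \<phi>) = of_int e2"
    "complex_of_real (\<beta> + 1 / \<beta>) * complex_of_real (2 * cos \<theta>) * complex_of_real (2 * cos \<phi>) = of_int e3"
    and trans: "\<And>F. intpoly_fun F \<Longrightarrow>
       F (complex_of_real (2 * cos \<theta>)) = 0 \<or> F (complex_of_real (2 * cos \<phi>)) = 0 \<Longrightarrow> F (complex_of_real (\<beta> + 1 / \<beta>)) = 0"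
    by blast
  show ?thesis
  proof (rule that[of \<theta> \<phi>])
    show "cos (real k * \<theta>) \<noteq> cos (real l * \<phi>)" if "k > 0 \<or> l > 0" for k l :: nat
      by (rule no_cosine_relation[where \<beta> = \<beta> and ?e1.0 = e1 and ?e2.0 = e2 and ?e3.0 = e3])
        (fact \<beta>, fact e(1), fact e(2), fact e(3), erule (1) trans, fact that)
  next
    fix m t u v
    assume tuv: "t = \<beta> ^ m + 1 / \<beta> ^ m" "u = 2 * cos (real m * \<theta>)" "v = 2 * cos (real m * \<phi>)"
    obtain a b c where abc: "\<And>x. x ^ 3 = of_int e1 * x\<^sup>2 - of_int e2 * x + of_int e3 \<Longrightarrow>
      dickson m x = of_int a + of_int b * x + of_int c * x\<^sup>2"
      using dickson_mod_cubic by blast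
    define T where "T = complex_of_real (\<beta> + 1 / \<beta>)"
    define U where "U = complex_of_real (2 * cos \<theta>)"
    define V where "V = complex_of_real (2 * cos \<phi>)"
    note e' = e[folded T_def U_def V_def]
    have "dickson m T = of_real t"
      using dickson_plus_inverse[of "of_real \<beta>" m] \<beta> tuv by (simp add: T_def)
    moreover have "dickson m U = of_real u" "dickson m V = of_real v"
      unfolding U_def V_def tuv by (rule dickson_cos)+
    moreover have "dickson m T = of_int a + of_int b * T + of_int c * T\<^sup>2"
      "dickson m U = of_int a + of_int b * U + of_int c * U\<^sup>2"
      "dickson m V = of_int a + of_int b * V + of_int c * V\<^sup>2"
      using cubic_root_of_symmetric[of T U V] cubic_root_of_symmetric[of U V T] cubic_root_of_symmetric[of V T U] e'
      by (intro abc; simp add: ac_simps)+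
    ultimately have f: "complex_of_real t = of_int a + of_int b * T + of_int c * T\<^sup>2"
      "complex_of_real u = of_int a + of_int b * U + of_int c * U\<^sup>2"
      "complex_of_real v = of_int a + of_int b * V + of_int c * V\<^sup>2" by simp_all
    note sym = symmetric_quadratic_values[OF e', of "of_int a" "of_int b" "of_int c", folded f]
    have Ints: "x \<in> \<int>" if "complex_of_real x = of_int n" for x n
      using that by (metis Ints_of_int of_real_eq_iff of_real_of_int_eq)
    have "t + u + v \<in> \<int>"
      by (rule Ints[of _ "3 * a + b * e1 + c * (e1\<^sup>2 - 2 * e2)"]) (use sym(1) in simp)
    moreover have "t * u + t * v + u * v \<in> \<int>"
      by (rule Ints[of _ "3 * a\<^sup>2 + 2 * a * b * e1 + 2 * a * c * (e1\<^sup>2 - 2 * e2)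
      + b\<^sup>2 * e2 + b * c * (e1 * e2 - 3 * e3) + c\<^sup>2 * (e2\<^sup>2 - 2 * e1 * e3)"]) (use sym(2) in simp)
    moreover have "t * u * v \<in> \<int>"
      by (rule Ints[of _ "a ^ 3 + a\<^sup>2 * b * e1 + a\<^sup>2 * c * (e1\<^sup>2 - 2 * e2) + a * b\<^sup>2 * e2
      + a * b * c * (e1 * e2 - 3 * e3) + a * c\<^sup>2 * (e2\<^sup>2 - 2 * e1 * e3) + b ^ 3 * e3
      + b\<^sup>2 * c * (e1 * e3) + b * c\<^sup>2 * (e2 * e3) + c ^ 3 * e3\<^sup>2"]) (use sym(3) in simp)
    \<comment> \<open>Multiplied out, the required quantities are the first symmetric function of t,
      u, v, the second plus 2, and the third plus twice the first.\<close>
    ultimately have "t + u + v \<in> \<int>" "(t * u + t * v + u * v) + 2 \<in> \<int>" "t * u * v + 2 * (t + u + v) \<in> \<int>"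
      using Ints_add[OF _ Ints_numeral] Ints_add[OF _ Ints_mult[OF Ints_numeral]] by blast+
    then show "t + (u + v) \<in> \<int> \<and> t * (u + v) + (2 + u * v) \<in> \<int> \<and> t * (2 + u * v) + 2 * (u + v) \<in> \<int>"
      by (simp add: algebra_simps)
  qed
qed

subsection \<open>Equidistribution\<close>

definition has_mean :: "(nat \<Rightarrow> real) \<Rightarrow> real \<Rightarrow> bool" where
  "has_mean g L \<longleftrightarrow> (\<lambda>M. (\<Sum>m=1..M. g m) / real M) \<longlonglongrightarrow> L"

lemma has_mean_const: "has_mean (\<lambda>_. c) c"
proof -
  have "\<forall>\<^sub>F M in sequentially. (\<Sum>m=1..M. c) / real M = c"
    using eventually_gt_at_top[of 0] by eventually_elim simp
  then show ?thesis unfolding has_mean_def by (rule tendsto_eventually)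
qed

lemma has_mean_add:
  "has_mean f a \<Longrightarrow> has_mean g b \<Longrightarrow> has_mean (\<lambda>m. f m + g m) (a + b)"
  unfolding has_mean_def by (simp add: sum.distrib add_divide_distrib tendsto_add)

lemma has_mean_scale: "has_mean f a \<Longrightarrow> has_mean (\<lambda>m. c * f m) (c * a)"
  unfolding has_mean_def
  by (drule tendsto_mult_left[where c = c]) (simp add: sum_distrib_left)

text \<open>Averages inherit a uniform error. Three errors occur: that of the averages, that of the
  convergence for g, and that between the two limits; a quarter of the tolerance for each is
  enough.\<close>

lemma has_mean_approx:
  assumes "\<And>e. e > 0 \<Longrightarrow> \<exists>g L'. has_mean g L' \<and> (\<forall>m. \<bar>f m - g m\<bar> \<le> e) \<and> \<bar>L - L'\<bar> \<le> e"
  shows "has_mean f L"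
  unfolding has_mean_def
proof (rule LIMSEQ_I)
  fix r :: real assume "r > 0"
  then obtain g L' where g: "has_mean g L'" "\<And>m. \<bar>f m - g m\<bar> \<le> r / 4" "\<bar>L - L'\<bar> \<le> r / 4"
    using assms[of "r / 4"] by auto
  from g(1) \<open>r > 0\<close> obtain n0 where n0: "\<And>M. M \<ge> n0 \<Longrightarrow> norm ((\<Sum>m=1..M. g m) / real M - L') < r / 4"
    unfolding has_mean_def using LIMSEQ_D[of _ L' "r / 4"] by (auto simp del: real_norm_def)
  have "norm ((\<Sum>m=1..M. f m) / real M - L) < r" if "M \<ge> n0" for M
  proof -
    have "\<bar>(\<Sum>m=1..M. f m) - (\<Sum>m=1..M. g m)\<bar> \<le> (\<Sum>m=1..M. r / 4)"
      unfolding sum_subtractf[symmetric] by (rule order_trans[OF sum_abs]) (rule sum_mono, rule g(2))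
    also have "\<dots> = real M * (r / 4)" by simp
    finally have "\<bar>(\<Sum>m=1..M. f m) / real M - (\<Sum>m=1..M. g m) / real M\<bar> \<le> r / 4"
      using \<open>r > 0\<close> by (cases "M = 0") (auto simp: diff_divide_distrib[symmetric] divide_simps mult.commute)
    with n0[OF that] g(3) \<open>r > 0\<close> show ?thesis unfolding real_norm_def by linarith
  qed
  then show "\<exists>no. \<forall>n\<ge>no. norm ((\<Sum>m=1..n. f m) / real n - L) < r" by blast
qed

text \<open>Multiplication by 2 sin(x/2) telescopes the sum, so all partial sums are bounded; cos x
  \<noteq> 1 makes this factor nonzero.\<close>

lemma has_mean_cos:
  assumes "cos x \<noteq> 1"
  shows "has_mean (\<lambda>m. cos (real m * x)) 0"
proof -
  have s: "sin (x / 2) \<noteq> 0"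
    using assms cos_double_sin[of "x / 2"] by auto
  have tele: "2 * sin (x / 2) * (\<Sum>m=1..M. cos (real m * x)) = sin ((real M + 1 / 2) * x) - sin (x / 2)" for M
  proof (induction M)
    case (Suc M)
    have "2 * sin (x / 2) * cos (real (Suc M) * x)
      = sin ((real (Suc M) + 1 / 2) * x) - sin ((real M + 1 / 2) * x)"
    proof -
      have "(real (Suc M) + 1 / 2) * x = real (Suc M) * x + x / 2"
        "(real M + 1 / 2) * x = real (Suc M) * x - x / 2" by (simp_all add: field_simps)
      then show ?thesis by (simp only: sin_add sin_diff) simp
    qed
    with Suc show ?case by (simp add: distrib_left)
  qed simp
  have bnd: "\<bar>\<Sum>m=1..M. cos (real m * x)\<bar> \<le> 1 / \<bar>sin (x / 2)\<bar>" for M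
  proof -
    have "\<bar>2 * sin (x / 2) * (\<Sum>m=1..M. cos (real m * x))\<bar> \<le> 2"
      unfolding tele using abs_sin_le_one[of "(real M + 1 / 2) * x"] abs_sin_le_one[of "x / 2"] by linarith
    then show ?thesis using s by (simp add: abs_mult field_simps)
  qed
  have "(\<lambda>M. (1 / \<bar>sin (x / 2)\<bar>) / real M) \<longlonglongrightarrow> 0"
    by (rule lim_const_over_n)
  then show ?thesis unfolding has_mean_def
  proof (rule Lim_null_comparison[rotated])
    show "\<forall>\<^sub>F M in sequentially. norm ((\<Sum>m=1..M. cos (real m * x)) / real M) \<le> (1 / \<bar>sin (x / 2)\<bar>) / real M"
      by (rule always_eventually) (metis bnd abs_divide abs_of_nat divide_right_mono of_nat_0_le_iff real_norm_def)
  qed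
qed

lemma cos_add_neq_1:
  fixes x y :: real
  assumes "cos x \<noteq> cos y"
  shows "cos (x + y) \<noteq> 1" "cos (x - y) \<noteq> 1"
proof -
  have s: "sin z = 0" if "cos z = 1" for z :: real
    using that sin_cos_squared_add[of z] by simp
  show "cos (x - y) \<noteq> 1"
    using assms s[of "x - y"] cos_add[of "x - y" y] by auto
  show "cos (x + y) \<noteq> 1"
    using assms s[of "x + y"] cos_add[of "x + y" "- y"] by auto
qed

text \<open>The product is half the sum of the cosines at x - y and x + y. Neither angle is a
  multiple of a full turn, since the cosines of x and y would then agree.\<close>

lemma has_mean_cos_cos:
  assumes "cos x \<noteq> cos y"
  shows "has_mean (\<lambda>m. cos (real m * x) * cos (real m * y)) 0"
proof -
  have "has_mean (\<lambda>m. 1 / 2 * (cos (real m * (x - y)) + cos (real m * (x + y)))) (1 / 2 * (0 + 0))"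
    using cos_add_neq_1[OF assms] by (intro has_mean_scale has_mean_add has_mean_cos)
  moreover have "1 / 2 * (cos (real m * (x - y)) + cos (real m * (x + y))) = cos (real m * x) * cos (real m * y)" for m
    by (simp add: cos_times_cos right_diff_distrib distrib_left)
  ultimately show ?thesis by simp
qed

section \<open>Weyl's criterion for products of even functions\<close>

definition cosine_mean :: "(real \<Rightarrow> real) \<Rightarrow> real" where
  "cosine_mean f = integral {0..pi} f / pi"

text \<open>Even trigonometric polynomials. All test functions factor through the cosine, so half a
  period and no sines are needed.\<close>

inductive cosine_poly :: "(real \<Rightarrow> real) \<Rightarrow> bool" where
  cos: "cosine_poly (\<lambda>\<theta>. cos (real k * \<theta>))"
| add: "cosine_poly f \<Longrightarrow> cosine_poly g \<Longrightarrow> cosine_poly (\<lambda>\<theta>. f \<theta> + g \<theta>)"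
| scale: "cosine_poly f \<Longrightarrow> cosine_poly (\<lambda>\<theta>. c * f \<theta>)"

lemma cosine_poly_continuous: "cosine_poly f \<Longrightarrow> continuous_on S f"
  by (induction rule: cosine_poly.induct) (auto intro!: continuous_intros)

lemma cosine_poly_const: "cosine_poly (\<lambda>_. c)"
  using cosine_poly.scale[OF cosine_poly.cos[of 0], of c] by simp

lemma cosine_poly_mult:
  assumes "cosine_poly f" "cosine_poly g"
  shows "cosine_poly (\<lambda>\<theta>. f \<theta> * g \<theta>)"
  using assms(1)
proof (induction rule: cosine_poly.induct)
  case (cos k)
  show ?case using assms(2)
  proof (induction rule: cosine_poly.induct)
    case (cos l)
    \<comment> \<open>Frequencies are natural numbers, so the difference is taken in the order that
      avoids truncated subtraction; evenness of the cosine makes the order irrelevant.\<close>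
    have "cosine_poly (\<lambda>\<theta>. 1 / 2 * (cos (real (if k \<le> l then l - k else k - l) * \<theta>) + cos (real (k + l) * \<theta>)))"
      by (intro cosine_poly.intros)
    moreover have "cos (real (if k \<le> l then l - k else k - l) * \<theta>) = cos (real k * \<theta> - real l * \<theta>)" for \<theta>
      using cos_minus[of "real k * \<theta> - real l * \<theta>"]
      by (auto simp: of_nat_diff left_diff_distrib simp del: cos_minus)
    ultimately show ?case by (simp add: cos_times_cos distrib_right)
  next
    case (add f g)
    then show ?case using cosine_poly.add by (simp add: distrib_left)
  next
    case (scale f c)
    then show ?case using cosine_poly.scale[OF scale.IH, of c] by (simp add: mult.left_commute)
  qed
next
  case (add f1 f2)
  then show ?case using cosine_poly.add by (simp add: distrib_right)
next
  case (scale f c)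
  then show ?case using cosine_poly.scale[OF scale.IH, of c] by (simp add: mult.assoc)
qed

text \<open>This connects Weierstrass approximation on [-1, 1] in the variable cos \<theta> with
  finite cosine sums in \<theta>.\<close>

lemma cosine_poly_real_polynomial_function:
  "real_polynomial_function p \<Longrightarrow> cosine_poly (\<lambda>\<theta>. p (cos \<theta>))"
proof (induction rule: real_polynomial_function.induct)
  case (linear f)
  then obtain c where "\<And>x. f x = x * c" by (metis real_bounded_linear)
  then show ?case using cosine_poly.scale[OF cosine_poly.cos[of 1], of c] by (simp add: mult.commute)
qed (auto intro: cosine_poly_const cosine_poly.add cosine_poly_mult)

lemma cosine_mean_add:
  "continuous_on {0..pi} f \<Longrightarrow> continuous_on {0..pi} g \<Longrightarrow>
    cosine_mean (\<lambda>\<theta>. f \<theta> + g \<theta>) = cosine_mean f + cosine_mean g"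
  unfolding cosine_mean_def
  by (simp add: integral_add integrable_continuous_real add_divide_distrib)

lemma cosine_mean_scale: "cosine_mean (\<lambda>\<theta>. c * f \<theta>) = c * cosine_mean f"
  unfolding cosine_mean_def by simp

lemma cosine_mean_cos: "cosine_mean (\<lambda>\<theta>. cos (real k * \<theta>)) = (if k = 0 then 1 else 0)"
proof (cases "k = 0")
  case False
  have "((\<lambda>\<theta>. cos (real k * \<theta>)) has_integral sin (real k * pi) / real k - sin (real k * 0) / real k) {0..pi}"
    using False
    by (intro fundamental_theorem_of_calculus)
       (auto intro!: derivative_eq_intros simp: has_real_derivative_iff_has_vector_derivative[symmetric])
  then show ?thesis using False by (simp add: cosine_mean_def integral_unique)
qed (simp add: cosine_mean_def)

text \<open>Both sides are bilinear in f and g, so single cosines suffice. Their product has mean 0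
  unless both frequencies vanish, exactly as the product of the integrals.\<close>

lemma has_mean_cosine_poly:
  assumes ind: "\<And>k l :: nat. k > 0 \<or> l > 0 \<Longrightarrow> cos (real k * \<alpha>) \<noteq> cos (real l * \<beta>)"
    and f: "cosine_poly f" and g: "cosine_poly g"
  shows "has_mean (\<lambda>m. f (real m * \<alpha>) * g (real m * \<beta>)) (cosine_mean f * cosine_mean g)"
  using f
proof (induction rule: cosine_poly.induct)
  case (cos k)
  show ?case using g
  proof (induction rule: cosine_poly.induct)
    case (cos l)
    show ?case
    proof (cases "k > 0 \<or> l > 0")
      case True
      have "has_mean (\<lambda>m. cos (real m * (real k * \<alpha>)) * cos (real m * (real l * \<beta>))) 0"
        by (rule has_mean_cos_cos) (rule ind[OF True])
      then show ?thesis using True by (auto simp: cosine_mean_cos mult.left_commute)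
    qed (use has_mean_const[of 1] in \<open>simp add: cosine_mean_def\<close>)
  next
    case (add f g)
    then show ?case using has_mean_add
      by (fastforce simp: cosine_mean_add cosine_poly_continuous distrib_left)
  next
    case (scale f c)
    then show ?case using has_mean_scale[OF scale.IH, of c]
      by (simp add: cosine_mean_scale mult.left_commute)
  qed
next
  case (add f1 f2)
  then show ?case using has_mean_add
    by (fastforce simp: cosine_mean_add cosine_poly_continuous distrib_right)
next
  case (scale f c)
  then show ?case using has_mean_scale[OF scale.IH, of c]
    by (simp add: cosine_mean_scale mult.assoc)
qed

lemma cosine_mean_diff_le:
  assumes "continuous_on {0..pi} f" "continuous_on {0..pi} g"
    and "\<And>\<theta>. \<theta> \<in> {0..pi} \<Longrightarrow> \<bar>f \<theta> - g \<theta>\<bar> \<le> e"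
  shows "\<bar>cosine_mean f - cosine_mean g\<bar> \<le> e"
proof -
  have eq: "cosine_mean f - cosine_mean g = integral {0..pi} (\<lambda>\<theta>. f \<theta> - g \<theta>) / pi"
    using assms by (simp add: cosine_mean_def integral_diff integrable_continuous_real diff_divide_distrib)
  have "norm (integral {0..pi} (\<lambda>\<theta>. f \<theta> - g \<theta>)) \<le> e * (pi - 0)"
    using assms by (intro integral_bound) (auto intro: continuous_intros)
  then show ?thesis unfolding eq by (simp add: field_simps)
qed

lemma has_mean_continuous:
  assumes ind: "\<And>k l :: nat. k > 0 \<or> l > 0 \<Longrightarrow> cos (real k * \<alpha>) \<noteq> cos (real l * \<beta>)"
    and F: "continuous_on {-1..1} F" "\<And>x. x \<in> {-1..1} \<Longrightarrow> \<bar>F x\<bar> \<le> 1"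
    and G: "continuous_on {-1..1} G" "\<And>x. x \<in> {-1..1} \<Longrightarrow> \<bar>G x\<bar> \<le> 1"
  shows "has_mean (\<lambda>m. F (cos (real m * \<alpha>)) * G (cos (real m * \<beta>)))
    (cosine_mean (\<lambda>\<theta>. F (cos \<theta>)) * cosine_mean (\<lambda>\<theta>. G (cos \<theta>)))"
proof (rule has_mean_approx)
  fix e :: real assume "e > 0"
  \<comment> \<open>The difference of the two products splits into three terms, each at most d; the
    quadratic one needs d \<le> 1.\<close>
  define d where "d = min 1 (e / 3)"
  have d: "d > 0" "d \<le> 1" "3 * d \<le> e" using \<open>e > 0\<close> by (auto simp: d_def)
  obtain p where p: "real_polynomial_function p" "\<And>x. x \<in> {-1..1} \<Longrightarrow> \<bar>F x - p x\<bar> < d"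
    using Stone_Weierstrass_real_polynomial_function[OF _ F(1) d(1)] by auto
  obtain q where q: "real_polynomial_function q" "\<And>x. x \<in> {-1..1} \<Longrightarrow> \<bar>G x - q x\<bar> < d"
    using Stone_Weierstrass_real_polynomial_function[OF _ G(1) d(1)] by auto
  note pc = cosine_poly_real_polynomial_function[OF p(1)]
  note qc = cosine_poly_real_polynomial_function[OF q(1)]
  have prod: "\<bar>a * b - a' * b'\<bar> \<le> e"
    if "\<bar>a\<bar> \<le> 1" "\<bar>b\<bar> \<le> 1" "\<bar>a - a'\<bar> \<le> d" "\<bar>b - b'\<bar> \<le> d" for a b a' b'
  proof -
    have "a * b - a' * b' = a * (b - b') + b * (a - a') - (a - a') * (b - b')"
      by (simp add: algebra_simps)
    moreover have "\<bar>a * (b - b')\<bar> \<le> 1 * d" "\<bar>b * (a - a')\<bar> \<le> 1 * d" "\<bar>(a - a') * (b - b')\<bar> \<le> 1 * d"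
      unfolding abs_mult using that d by (intro mult_mono; simp)+
    ultimately show ?thesis using d(3) by linarith
  qed
  have contF: "continuous_on {0..pi} (\<lambda>\<theta>. F (cos \<theta>))" "continuous_on {0..pi} (\<lambda>\<theta>. G (cos \<theta>))"
    by (rule continuous_on_compose2[OF F(1)] continuous_on_compose2[OF G(1)]; auto intro: continuous_intros)+
  have le1: "\<bar>cosine_mean (\<lambda>\<theta>. H (cos \<theta>))\<bar> \<le> 1"
    if "continuous_on {0..pi} (\<lambda>\<theta>. H (cos \<theta>))" "\<And>x. x \<in> {-1..1} \<Longrightarrow> \<bar>H x\<bar> \<le> 1" for H
    using cosine_mean_diff_le[OF that(1) continuous_on_const[of _ 0], of 1] that(2)
    by (auto simp: cosine_mean_def)
  show "\<exists>g L'. has_mean g L' \<and>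
      (\<forall>m. \<bar>F (cos (real m * \<alpha>)) * G (cos (real m * \<beta>)) - g m\<bar> \<le> e) \<and>
      \<bar>cosine_mean (\<lambda>\<theta>. F (cos \<theta>)) * cosine_mean (\<lambda>\<theta>. G (cos \<theta>)) - L'\<bar> \<le> e"
  proof (intro exI conjI allI)
    show "has_mean (\<lambda>m. p (cos (real m * \<alpha>)) * q (cos (real m * \<beta>)))
        (cosine_mean (\<lambda>\<theta>. p (cos \<theta>)) * cosine_mean (\<lambda>\<theta>. q (cos \<theta>)))"
      by (rule has_mean_cosine_poly[OF ind pc qc])
    show "\<bar>F (cos (real m * \<alpha>)) * G (cos (real m * \<beta>)) - p (cos (real m * \<alpha>)) * q (cos (real m * \<beta>))\<bar> \<le> e" for m
      using F(2) G(2) p(2) q(2) by (intro prod) (auto intro: less_imp_le)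
    show "\<bar>cosine_mean (\<lambda>\<theta>. F (cos \<theta>)) * cosine_mean (\<lambda>\<theta>. G (cos \<theta>)) -
       cosine_mean (\<lambda>\<theta>. p (cos \<theta>)) * cosine_mean (\<lambda>\<theta>. q (cos \<theta>))\<bar> \<le> e"
    proof (intro prod le1 F G contF)
      show "\<bar>cosine_mean (\<lambda>\<theta>. F (cos \<theta>)) - cosine_mean (\<lambda>\<theta>. p (cos \<theta>))\<bar> \<le> d"
        using p(2) by (intro cosine_mean_diff_le contF cosine_poly_continuous pc) (auto intro: less_imp_le)
      show "\<bar>cosine_mean (\<lambda>\<theta>. G (cos \<theta>)) - cosine_mean (\<lambda>\<theta>. q (cos \<theta>))\<bar> \<le> d"
        using q(2) by (intro cosine_mean_diff_le contF cosine_poly_continuous qc) (auto intro: less_imp_le)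
    qed
  qed
qed

section \<open>Lower density of boxes of folded angles\<close>

definition lower_density_ge :: "nat set \<Rightarrow> real \<Rightarrow> bool" where
  "lower_density_ge X a \<longleftrightarrow> (\<forall>\<delta>>0. \<forall>\<^sub>F M in sequentially. a - \<delta> \<le> real (card (X \<inter> {1..M})) / real M)"

lemma lower_density_ge_empty: "lower_density_ge {} 0"
  by (simp add: lower_density_ge_def)

lemma lower_density_ge_Un:
  assumes "lower_density_ge X a" "lower_density_ge Y b" "X \<inter> Y = {}"
  shows "lower_density_ge (X \<union> Y) (a + b)"
  unfolding lower_density_ge_def
proof (intro allI impI)
  fix \<delta> :: real assume "\<delta> > 0"
  then have "\<forall>\<^sub>F M in sequentially. a - \<delta> / 2 \<le> real (card (X \<inter> {1..M})) / real M"
    "\<forall>\<^sub>F M in sequentially. b - \<delta> / 2 \<le> real (card (Y \<inter> {1..M})) / real M"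
    using assms(1,2) half_gt_zero unfolding lower_density_ge_def by blast+
  then show "\<forall>\<^sub>F M in sequentially. a + b - \<delta> \<le> real (card ((X \<union> Y) \<inter> {1..M})) / real M"
  proof eventually_elim
    case (elim M)
    have "card ((X \<union> Y) \<inter> {1..M}) = card (X \<inter> {1..M}) + card (Y \<inter> {1..M})"
      unfolding Int_Un_distrib2 using assms(3) by (intro card_Un_disjoint) auto
    then show ?case using elim by (simp add: add_divide_distrib)
  qed
qed

text \<open>The threshold \<open>m0\<close> makes room for finitely many exceptions: the expansions
  are controlled only once \<open>\<beta> ^ m\<close> is large.\<close>

lemma lower_density_ge_mono:
  assumes "lower_density_ge X a" "\<And>m. m \<in> X \<Longrightarrow> m \<ge> m0 \<Longrightarrow> m \<in> Y"
  shows "lower_density_ge Y a"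
  unfolding lower_density_ge_def
proof (intro allI impI)
  fix \<delta> :: real assume "\<delta> > 0"
  then have "\<forall>\<^sub>F M in sequentially. a - \<delta> / 2 \<le> real (card (X \<inter> {1..M})) / real M"
    using assms(1) half_gt_zero unfolding lower_density_ge_def by blast
  moreover have "\<forall>\<^sub>F M in sequentially. real m0 / real M < \<delta> / 2"
    using lim_const_over_n[of "real m0"] \<open>\<delta> > 0\<close> by (intro order_tendstoD) auto
  ultimately show "\<forall>\<^sub>F M in sequentially. a - \<delta> \<le> real (card (Y \<inter> {1..M})) / real M"
  proof eventually_elim
    case (elim M)
    have "X \<inter> {1..M} \<subseteq> (Y \<inter> {1..M}) \<union> {..<m0}"
      using assms(2) not_le by auto
    then have "card (X \<inter> {1..M}) \<le> card (Y \<inter> {1..M} \<union> {..<m0})" by (intro card_mono) auto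
    also have "\<dots> \<le> card (Y \<inter> {1..M}) + m0" using card_Un_le[of "Y \<inter> {1..M}" "{..<m0}"] by simp
    finally have "real (card (X \<inter> {1..M})) / real M \<le> real (card (Y \<inter> {1..M})) / real M + real m0 / real M"
      unfolding add_divide_distrib[symmetric] by (intro divide_right_mono) auto
    then show ?case using elim by linarith
  qed
qed

definition fold_angle :: "real \<Rightarrow> real" where "fold_angle x = arccos (cos x)"

text \<open>A continuous minorant of the indicator of the open interval (a, b) in the angle, equal
  to 1 on [a + e, b - e]. As a function of the cosine it is the trapezoid composed with
  \<open>arccos\<close>.\<close>

lemma trapezoid:
  fixes a b e :: real
  assumes ab: "0 \<le> a" "b \<le> pi" and e: "e > 0" "2 * e < b - a"
  obtains F where "continuous_on {-1..1} F" "\<And>x. 0 \<le> F x" "\<And>x. F x \<le> 1"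
    "\<And>x. F (cos x) > 0 \<Longrightarrow> a < fold_angle x \<and> fold_angle x < b"
    "cosine_mean (\<lambda>\<theta>. F (cos \<theta>)) \<ge> (b - a - 2 * e) / pi"
proof -
  define h where "h \<theta> = max 0 (min 1 (min (\<theta> - a) (b - \<theta>) / e))" for \<theta>
  define F where "F x = h (arccos x)" for x
  have hc: "continuous_on S h" for S
    unfolding h_def using e by (intro continuous_intros) auto
  have c: "continuous_on {-1..1} F"
    unfolding F_def by (rule continuous_on_compose2[OF hc[of UNIV] continuous_on_arccos']) auto
  have "integral {a+e..b-e} (\<lambda>_. 1) \<le> integral {0..pi} h"
  proof -
    have "integral {a+e..b-e} (\<lambda>_. 1) \<le> integral {a+e..b-e} h"
      using e by (intro integral_le integrable_continuous_real hc continuous_intros)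
        (auto simp: h_def field_simps)
    also have "\<dots> \<le> integral {0..pi} h"
      using ab e by (intro integral_subset_le integrable_continuous_real hc) (auto simp: h_def)
    finally show ?thesis .
  qed
  also have "integral {0..pi} h = integral {0..pi} (\<lambda>\<theta>. F (cos \<theta>))"
    by (intro integral_cong) (auto simp: F_def arccos_cos)
  finally have "(b - a - 2 * e) / pi \<le> cosine_mean (\<lambda>\<theta>. F (cos \<theta>))"
    using e by (simp add: cosine_mean_def divide_right_mono)
  moreover have "a < fold_angle x \<and> fold_angle x < b" if "F (cos x) > 0" for x
    using that e by (auto simp: F_def h_def fold_angle_def field_simps less_max_iff_disj min_def split: if_splits)
  ultimately show ?thesis using that[OF c] by (auto simp: F_def h_def)
qed

text \<open>Only a lower bound is wanted, so a minorant on each axis suffices: the product of two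
  trapezoids counts no m outside the box, and its mean tends to the area of the box as e tends to
  0.\<close>

lemma lower_density_box:
  assumes ind: "\<And>k l :: nat. k > 0 \<or> l > 0 \<Longrightarrow> cos (real k * \<alpha>) \<noteq> cos (real l * \<beta>)"
    and ab: "0 \<le> a" "a < b" "b \<le> pi" and cd: "0 \<le> c" "c < d" "d \<le> pi"
  shows "lower_density_ge {m. a < fold_angle (real m * \<alpha>) \<and> fold_angle (real m * \<alpha>) < b \<and>
      c < fold_angle (real m * \<beta>) \<and> fold_angle (real m * \<beta>) < d} ((b - a) / pi * ((d - c) / pi))"
    (is "lower_density_ge ?X _")
  unfolding lower_density_ge_def
proof (intro allI impI)
  fix \<delta> :: real assume "\<delta> > 0"
  have "((\<lambda>e. (b - a - 2 * e) / pi * ((d - c - 2 * e) / pi)) \<longlongrightarrow>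
      (b - a - 2 * 0) / pi * ((d - c - 2 * 0) / pi)) (at_right 0)"
    by (intro tendsto_intros) auto
  then have "\<forall>\<^sub>F e in at_right 0. (b - a) / pi * ((d - c) / pi) - \<delta> / 2 < (b - a - 2 * e) / pi * ((d - c - 2 * e) / pi)"
    using \<open>\<delta> > 0\<close> by (intro order_tendstoD) auto
  moreover have "\<forall>\<^sub>F e in at_right 0. e < min ((b - a) / 2) ((d - c) / 2) \<and> e > 0"
    using ab cd by (auto simp: eventually_at_right_field intro!: exI[of _ "min ((b - a) / 2) ((d - c) / 2)"])
  ultimately have "\<forall>\<^sub>F e in at_right 0. e > 0 \<and> 2 * e < b - a \<and> 2 * e < d - c \<and>
    (b - a) / pi * ((d - c) / pi) - \<delta> / 2 < (b - a - 2 * e) / pi * ((d - c - 2 * e) / pi)"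
    by eventually_elim auto
  then obtain e where e: "e > 0" "2 * e < b - a" "2 * e < d - c"
    "(b - a) / pi * ((d - c) / pi) - \<delta> / 2 < (b - a - 2 * e) / pi * ((d - c - 2 * e) / pi)"
    using eventually_happens'[OF trivial_limit_at_right_real] by blast
  from trapezoid[OF ab(1,3) e(1,2)] obtain F where F: "continuous_on {-1..1} F"
    "\<And>x. 0 \<le> F x" "\<And>x. F x \<le> 1" "\<And>x. F (cos x) > 0 \<Longrightarrow> a < fold_angle x \<and> fold_angle x < b"
    "cosine_mean (\<lambda>\<theta>. F (cos \<theta>)) \<ge> (b - a - 2 * e) / pi" by metis
  from trapezoid[OF cd(1,3) e(1,3)] obtain G where G: "continuous_on {-1..1} G"
    "\<And>x. 0 \<le> G x" "\<And>x. G x \<le> 1" "\<And>x. G (cos x) > 0 \<Longrightarrow> c < fold_angle x \<and> fold_angle x < d"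
    "cosine_mean (\<lambda>\<theta>. G (cos \<theta>)) \<ge> (d - c - 2 * e) / pi" by metis
  have "(b - a - 2 * e) / pi * ((d - c - 2 * e) / pi) \<le> cosine_mean (\<lambda>\<theta>. F (cos \<theta>)) * cosine_mean (\<lambda>\<theta>. G (cos \<theta>))"
    using F(5) G(5) e order_trans[OF _ F(5), of 0] by (intro mult_mono) auto
  then have lim: "(b - a) / pi * ((d - c) / pi) - \<delta> <
      cosine_mean (\<lambda>\<theta>. F (cos \<theta>)) * cosine_mean (\<lambda>\<theta>. G (cos \<theta>))"
    using e(4) \<open>\<delta> > 0\<close> by linarith
  have "has_mean (\<lambda>m. F (cos (real m * \<alpha>)) * G (cos (real m * \<beta>)))
    (cosine_mean (\<lambda>\<theta>. F (cos \<theta>)) * cosine_mean (\<lambda>\<theta>. G (cos \<theta>)))"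
    using F(1-3) G(1-3) by (intro has_mean_continuous ind) (simp_all only: abs_of_nonneg)
  from order_tendstoD(1)[OF this[unfolded has_mean_def] lim]
  show "\<forall>\<^sub>F M in sequentially. (b - a) / pi * ((d - c) / pi) - \<delta> \<le> real (card (?X \<inter> {1..M})) / real M"
  proof eventually_elim
    case (elim M)
    have "(\<Sum>m=1..M. F (cos (real m * \<alpha>)) * G (cos (real m * \<beta>))) \<le> (\<Sum>m=1..M. indicator ?X m)"
    proof (rule sum_mono)
      fix m
      have le1: "F (cos (real m * \<alpha>)) * G (cos (real m * \<beta>)) \<le> 1 * 1"
        using F(2,3) G(2,3) by (intro mult_mono) auto
      have mem: "m \<in> ?X" if "F (cos (real m * \<alpha>)) * G (cos (real m * \<beta>)) > 0"
        using that F(2)[of "cos (real m * \<alpha>)"] G(2)[of "cos (real m * \<beta>)"] F(4)[of "real m * \<alpha>"] G(4)[of "real m * \<beta>"]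
        by (auto simp: zero_less_mult_iff)
      show "F (cos (real m * \<alpha>)) * G (cos (real m * \<beta>)) \<le> indicator ?X m"
      proof (cases "m \<in> ?X")
        case True
        show ?thesis using le1 unfolding indicator_simps(1)[OF True] mult_1 .
      next
        case False
        then have "\<not> F (cos (real m * \<alpha>)) * G (cos (real m * \<beta>)) > 0" using mem by blast
        then show ?thesis unfolding indicator_simps(2)[OF False] not_less .
      qed
    qed
    also have "\<dots> = real (card (?X \<inter> {1..M}))"
      unfolding indicator_def by (subst sum_of_bool_eq) (simp_all add: Int_commute)
    finally have "(\<Sum>m=1..M. F (cos (real m * \<alpha>)) * G (cos (real m * \<beta>))) / real M \<le> real (card (?X \<inter> {1..M})) / real M"
      by (rule divide_right_mono) simp
    then show ?case using elim by linarith
  qed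
qed

subsection \<open>Certified boxes\<close>

text \<open>The arguments a, b, c, d are the four entries preceding e, latest first. If b = 0 and a
  + c = 0, the coefficient is the integer e + d for all s and r, so it can lie in (0, 1] only as the
  exact value 1. Otherwise a margin \<delta> is required on both sides.\<close>

fun coeffs_ok :: "real \<Rightarrow> real \<Rightarrow> real \<Rightarrow> int list \<Rightarrow> int \<Rightarrow> int \<Rightarrow> int \<Rightarrow> int \<Rightarrow> bool" where
  "coeffs_ok s r \<delta> [] a b c d \<longleftrightarrow> True"
| "coeffs_ok s r \<delta> (e # es) a b c d \<longleftrightarrow>
    (if b = 0 \<and> a + c = 0 then e + d = 1
     else \<delta> \<le> conv_coeff s r e a b c d \<and> conv_coeff s r e a b c d \<le> 1 - \<delta>)
    \<and> coeffs_ok s r \<delta> es e a b c"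

lemma coeffs_ok_nth:
  assumes "coeffs_ok s r \<delta> es a b c d" "i < length es"
  defines "X \<equiv> d # c # b # a # es"
  shows "conv_coeff s r (X ! (i + 4)) (X ! (i + 3)) (X ! (i + 2)) (X ! (i + 1)) (X ! i) = 1 \<or>
    \<delta> \<le> conv_coeff s r (X ! (i + 4)) (X ! (i + 3)) (X ! (i + 2)) (X ! (i + 1)) (X ! i) \<and>
    conv_coeff s r (X ! (i + 4)) (X ! (i + 3)) (X ! (i + 2)) (X ! (i + 1)) (X ! i) \<le> 1 - \<delta>"
  using assms(1,2) unfolding X_def
proof (induction es arbitrary: a b c d i)
  case (Cons e es)
  show ?case
  proof (cases i)
    case 0
    have tie: "conv_coeff s r e a b c d = 1" if "b = 0" "a + c = 0" "e + d = 1"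
    proof -
      have "a = - c" "e = 1 - d" using that by simp_all
      then show ?thesis using that(1) by (simp add: conv_coeff_def)
    qed
    show ?thesis using Cons.prems tie 0 by (auto simp: eval_nat_numeral split: if_splits)
  next
    case (Suc k)
    then show ?thesis using Cons.IH[of e a b c k] Cons.prems by (simp add: eval_nat_numeral)
  qed
qed simp

text \<open>The list \<open>qs\<close> holds the coefficients of Q after the leading 1, which enters
  as the initial a; the empty list is Q = 1. The three zeros reach the remaining inner coefficients
  of the product with the quartic, whose constant term is 1 by \<open>last\<close>.\<close>

lemma mp_periodic_of_coeffs_ok:
  fixes B s r :: real
  assumes B: "B > 1" "1 / B < \<delta>"
    and t: "t = B + 1 / B"
    and i: "t + s \<in> \<int>" "t * s + r \<in> \<int>" "t * r + 2 * s \<in> \<int>"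
    and ok: "coeffs_ok s r \<delta> (qs @ [0, 0, 0]) 1 0 0 0"
    and last: "last (1 # qs) = 1"
  shows "\<exists>p. mp_periodic (beta_exp_one B) 1 p"
proof -
  have d0: "\<delta> > 0" using B by (smt (verit) divide_pos_pos)
  define H where "H = [0, 0, 0, 0, 1] @ qs"
  define h where "h j = (if j < length H then H ! j else 0)" for j
  have h: "([0, 0, 0, 1] @ qs @ [0, 0, 0]) ! j = h (Suc j)" if "j < length qs + 7" for j
  proof -
    have "([0, 0, 0, 1] @ qs @ [0, 0, 0]) ! j = (H @ [0, 0, 0]) ! Suc j" by (simp add: H_def)
    also have "\<dots> = h (Suc j)"
    proof (cases "Suc j < length H")
      case False
      then have "Suc j - length H \<in> {0, 1, 2}" using that by (auto simp: H_def)
      then have "[0, 0, 0 :: int] ! (Suc j - length H) = 0" by auto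
      then show ?thesis using False by (simp add: h_def nth_append)
    qed (simp add: h_def nth_append)
    finally show ?thesis .
  qed
  show ?thesis
  proof (rule mp_periodic_of_multiplier[OF B(1) t i, where h = h and d = "length qs"])
    show "h j = 0" if "j < 4" for j
    proof -
      from that have "j \<in> {0, 1, 2, 3}" by auto
      then show ?thesis by (auto simp: h_def H_def)
    qed
    show "h 4 = 1" by (simp add: h_def H_def)
    show "h (length qs + 4) = 1"
      using last by (cases qs rule: rev_cases) (auto simp: h_def H_def nth_append)
    show "h j = 0" if "length qs + 4 < j" for j using that by (simp add: h_def H_def)
  next
    fix n assume n: "1 \<le> n" "n \<le> length qs + 3"
    have idx: "([0, 0, 0, 1] @ qs @ [0, 0, 0]) ! (n - 1 + k) = h (n + k)" if "k \<le> 4" for k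
      using h[of "n - 1 + k"] n that by simp
    have "n - 1 < length (qs @ [0, 0, 0])" using n by simp
    from coeffs_ok_nth[OF ok this] idx[of 0] idx[of 1] idx[of 2] idx[of 3] idx[of 4]
    show "conv_coeff s r (h (n + 4)) (h (n + 3)) (h (n + 2)) (h (n + 1)) (h n) = 1 \<or>
      1 / B < conv_coeff s r (h (n + 4)) (h (n + 3)) (h (n + 2)) (h (n + 1)) (h n) \<and>
      conv_coeff s r (h (n + 4)) (h (n + 3)) (h (n + 2)) (h (n + 1)) (h n) \<le> 1"
      using B d0 by (auto simp del: nth_Cons_numeral)
  qed
qed

text \<open>Each entry of the multiplier is determined by its predecessors, as its coefficient has to lie in \<open>(0, 1]\<close>.\<close>

lemma coeffs_ok_prefix:
  assumes "\<delta> > 0" "coeffs_ok s r \<delta> xs a b c d" "coeffs_ok s r \<delta> ys a b c d" "length xs \<le> length ys"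
  shows "\<exists>zs. ys = xs @ zs"
  using assms(2-4)
proof (induction xs arbitrary: ys a b c d)
  case (Cons x xs)
  then obtain y ys' where ys: "ys = y # ys'" by (cases ys) auto
  have "x = y"
  proof (cases "b = 0 \<and> a + c = 0")
    case False
    then have "\<bar>conv_coeff s r x a b c d - conv_coeff s r y a b c d\<bar> < 1"
      using Cons.prems \<open>\<delta> > 0\<close> ys by auto
    then have "\<bar>real_of_int (x - y)\<bar> < 1" by (simp add: conv_coeff_def)
    then show ?thesis by linarith
  qed (use Cons.prems ys in auto)
  then show ?case using Cons.IH[of x a b c ys'] Cons.prems ys by auto
qed auto

text \<open>Three zeros in a row inside a multiplier could be mistaken for the padding after a
  shorter one.\<close>

fun has_three_zeros :: "int list \<Rightarrow> bool" where
  "has_three_zeros (a # b # c # xs) \<longleftrightarrow> a = 0 \<and> b = 0 \<and> c = 0 \<or> has_three_zeros (b # c # xs)"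
| "has_three_zeros _ \<longleftrightarrow> False"

lemma has_three_zeros_infix: "has_three_zeros (xs @ [0, 0, 0] @ ys)"
proof (induction xs)
  case (Cons x xs)
  obtain b c zs where "xs @ [0, 0, 0] @ ys = b # c # zs"
    by (cases xs; cases "tl xs") auto
  then show ?case using Cons by simp
qed simp

text \<open>By \<open>coeffs_ok_prefix\<close> one padded list extends the other. An excess of one
  or two entries would make the longer multiplier end in 0, and a larger excess would put the
  padding of the shorter one inside it.\<close>

lemma coeffs_ok_unique:
  assumes \<delta>: "\<delta> > 0"
    and qs: "coeffs_ok s r \<delta> (qs @ [0, 0, 0]) 1 0 0 0" "last (1 # qs) = 1" "\<not> has_three_zeros qs"
    and ps: "coeffs_ok s r \<delta> (ps @ [0, 0, 0]) 1 0 0 0" "last (1 # ps) = 1" "\<not> has_three_zeros ps"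
  shows "qs = ps"
proof -
  have *: "xs = ys"
    if "xs @ [0, 0, 0] @ zs = ys @ [0, 0, 0 :: int]" "last (1 # ys) = 1" "\<not> has_three_zeros ys" for xs ys zs
  proof -
    consider "zs = []" | z where "zs = [z]" | z z' where "zs = [z, z']" | ws z z' z'' where "zs = ws @ [z, z', z'']"
    proof -
      assume r: "zs = [] \<Longrightarrow> thesis" "\<And>z. zs = [z] \<Longrightarrow> thesis" "\<And>z z'. zs = [z, z'] \<Longrightarrow> thesis"
        "\<And>ws z z' z''. zs = ws @ [z, z', z''] \<Longrightarrow> thesis"
      show thesis
      proof (cases zs rule: rev_cases)
        case snoc1: (snoc zs1 z1)
        show thesis
        proof (cases zs1 rule: rev_cases)
          case snoc2: (snoc zs2 z2)
          show thesis by (cases zs2 rule: rev_cases) (use r snoc1 snoc2 in simp_all)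
        qed (use r snoc1 in simp)
      qed (use r in simp)
    qed
    then show ?thesis
    proof cases
      case 1
      then show ?thesis using that(1) by simp
    next
      case 2
      then have "ys = xs @ [0]" using that(1) by simp
      then show ?thesis using that(2) by simp
    next
      case 3
      then have "ys = xs @ [0, 0]" using that(1) by simp
      then show ?thesis using that(2) by simp
    next
      case 4
      then have "ys = xs @ [0, 0, 0] @ ws" using that(1) by simp
      then show ?thesis using that(3) has_three_zeros_infix by blast
    qed
  qed
  show ?thesis
  proof (cases "length qs \<le> length ps")
    case True
    then obtain zs where "ps @ [0, 0, 0] = (qs @ [0, 0, 0]) @ zs"
      using coeffs_ok_prefix[OF \<delta> qs(1) ps(1)] by auto
    then show ?thesis using *[of qs zs ps] ps by simp
  next
    case False
    then obtain zs where "qs @ [0, 0, 0] = (ps @ [0, 0, 0]) @ zs"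
      using coeffs_ok_prefix[OF \<delta> ps(1) qs(1)] by auto
    then show ?thesis using *[of ps zs qs] qs by simp
  qed
qed

text \<open>For either variable fixed the function is affine in the other, so a lower bound at the
  ends of an interval holds throughout; this is used along the v-edges and then in the direction of
  u.\<close>

lemma bilinear_bounds:
  fixes a b c d u v :: real
  assumes u: "u0 \<le> u" "u \<le> u1" and v: "v0 \<le> v" "v \<le> v1"
    and lower: "l \<le> a + b * u0 + c * v0 + d * (u0 * v0)" "l \<le> a + b * u0 + c * v1 + d * (u0 * v1)"
      "l \<le> a + b * u1 + c * v0 + d * (u1 * v0)" "l \<le> a + b * u1 + c * v1 + d * (u1 * v1)"
  shows "l \<le> a + b * u + c * v + d * (u * v)"
proof -
  define f where "f u v = a + b * u + c * v + d * (u * v)" for u v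
  have lin: "l \<le> p + q * x" if "l \<le> p + q * x0" "l \<le> p + q * x1" "x0 \<le> x" "x \<le> x1" for p q x x0 x1 :: real
  proof (cases "q \<ge> 0")
    case True
    then have "q * x0 \<le> q * x" using that by (simp add: mult_left_mono)
    then show ?thesis using that by linarith
  next
    case False
    then have "q * x1 \<le> q * x" using that by (simp add: mult_left_mono_neg)
    then show ?thesis using that by linarith
  qed
  have row: "l \<le> f u' v" if "l \<le> f u' v0" "l \<le> f u' v1" for u'
    using lin[of "a + b * u'" "c + d * u'" v0 v1 v] that v unfolding f_def by (simp add: algebra_simps)
  show ?thesis
    using lin[of "a + c * v" "b + d * v" u0 u1 u] row[of u0] row[of u1] lower[folded f_def] u
    unfolding f_def by (simp add: algebra_simps)
qed

text \<open>In terms of s = u + v and r = 2 + u v each coefficient is bilinear in (u, v). Upper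
  bounds follow by applying \<open>bilinear_bounds\<close> to 1 minus the coefficient.\<close>

lemma coeffs_ok_box:
  assumes u: "u0 \<le> u" "u \<le> u1" and v: "v0 \<le> v" "v \<le> v1"
    and "coeffs_ok (u0 + v0) (2 + u0 * v0) \<delta> es a b c d"
    and "coeffs_ok (u0 + v1) (2 + u0 * v1) \<delta> es a b c d"
    and "coeffs_ok (u1 + v0) (2 + u1 * v0) \<delta> es a b c d"
    and "coeffs_ok (u1 + v1) (2 + u1 * v1) \<delta> es a b c d"
  shows "coeffs_ok (u + v) (2 + u * v) \<delta> es a b c d"
  using assms(5-8)
proof (induction es arbitrary: a b c d)
  case (Cons e es)
  let ?f = "\<lambda>u v. conv_coeff (u + v) (2 + u * v) e a b c d"
  have f: "?f u v = of_int (e + 2 * b + d) + - of_int (a + c) * u + - of_int (a + c) * v + of_int b * (u * v)" for u v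
    by (simp add: conv_coeff_def algebra_simps)
  have f': "1 - ?f u v = of_int (1 - (e + 2 * b + d)) + of_int (a + c) * u + of_int (a + c) * v + - of_int b * (u * v)" for u v
    by (simp add: conv_coeff_def algebra_simps)
  have "\<delta> \<le> ?f u v \<and> ?f u v \<le> 1 - \<delta>" if "\<not> (b = 0 \<and> a + c = 0)"
  proof -
    have p: "\<delta> \<le> ?f u0 v0" "\<delta> \<le> ?f u0 v1" "\<delta> \<le> ?f u1 v0" "\<delta> \<le> ?f u1 v1"
      "\<delta> \<le> 1 - ?f u0 v0" "\<delta> \<le> 1 - ?f u0 v1" "\<delta> \<le> 1 - ?f u1 v0" "\<delta> \<le> 1 - ?f u1 v1"
      using Cons.prems that by auto
    have "\<delta> \<le> ?f u v"
      using bilinear_bounds[OF u v, of \<delta> "of_int (e + 2 * b + d)" "- of_int (a + c)" "- of_int (a + c)" b] p(1-4)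
      unfolding f by (simp only:)
    moreover have "\<delta> \<le> 1 - ?f u v"
      using bilinear_bounds[OF u v, of \<delta> "of_int (1 - (e + 2 * b + d))" "of_int (a + c)" "of_int (a + c)" "- of_int b"] p(5-8)
      unfolding f' by (simp only:)
    ultimately show ?thesis by simp
  qed
  then show ?case using Cons by auto
qed simp

section \<open>Integer arithmetic on the grid of angles\<close>

definition strictly_between :: "int \<Rightarrow> int \<Rightarrow> bool" where
  "strictly_between K z \<longleftrightarrow> 0 < z \<and> z < K"

text \<open>The conditions of \<open>coeffs_ok\<close> multiplied by K. Passing the coefficient to
  \<open>strictly_between\<close> lets its value be shared by both comparisons.\<close>

fun int_coeffs_ok :: "int \<Rightarrow> int \<Rightarrow> int \<Rightarrow> int list \<Rightarrow> int \<Rightarrow> int \<Rightarrow> int \<Rightarrow> int \<Rightarrow> bool" where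
  "int_coeffs_ok K x y [] a b c d \<longleftrightarrow> True"
| "int_coeffs_ok K x y (e # es) a b c d \<longleftrightarrow>
    (if b = 0 \<and> a + c = 0 then e + d = 1
     else strictly_between K ((e + d) * K - (a + c) * x + b * y))
    \<and> int_coeffs_ok K x y es e a b c"

text \<open>An integer strictly between 0 and K is at least 1 away from both ends; after division by
  K this is the margin \<delta> = 1/K.\<close>

lemma int_coeffs_ok:
  assumes "K > 0" "int_coeffs_ok K x y es a b c d"
  shows "coeffs_ok (x / K) (y / K) (1 / K) es a b c d"
  using assms(2)
proof (induction es arbitrary: a b c d)
  case (Cons e es)
  define z where "z = (e + d) * K - (a + c) * x + b * y"
  have z: "conv_coeff (x / K) (y / K) e a b c d = z / K"
    using assms(1) by (simp add: conv_coeff_def z_def field_simps)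
  have "1 / K \<le> z / K \<and> z / K \<le> 1 - 1 / K" if "0 < z" "z < K"
  proof -
    have "1 \<le> real_of_int z" "real_of_int z + 1 \<le> K" using that by linarith+
    then show ?thesis using assms(1) by (simp add: field_simps)
  qed
  then show ?case using Cons by (auto simp: z z_def[symmetric] strictly_between_def)
qed simp

text \<open>A table bounds \<open>2 cos (i \<pi> / 512)\<close> for \<open>0 \<le> i \<le> 256\<close>, scaled by \<open>65536 = 2\<^sup>1\<^sup>6\<close>; products of two such
  bounds are thus scaled by \<open>4294967296 = 2\<^sup>3\<^sup>2\<close>. The checks avoid \<open>let\<close> and \<open>\<lambda>\<close>, under which the simplifier
  would evaluate symbolically.\<close>

type_synonym bound_table = "int \<Rightarrow> int \<times> int"

fun negate_bounds :: "int \<times> int \<Rightarrow> int \<times> int" where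
  "negate_bounds (a, b) = (- b, - a)"

definition cos_bounds :: "bound_table \<Rightarrow> int \<Rightarrow> int \<times> int" where
  "cos_bounds t i = (if i \<le> 256 then t i else negate_bounds (t (512 - i)))"

fun half_angle_ok :: "int \<times> int \<Rightarrow> int \<times> int \<Rightarrow> bool" where
  "half_angle_ok (a, b) (a', b') \<longleftrightarrow>
    0 \<le> a \<and> 0 \<le> b \<and> a * a \<le> 65536 * (131072 + a') \<and> 65536 * (131072 + b') \<le> b * b"

definition bound_ok :: "bound_table \<Rightarrow> int \<Rightarrow> bool" where
  "bound_ok t i \<longleftrightarrow> half_angle_ok (t i) (cos_bounds t (2 * i))"

text \<open>The bounds are certified by the half-angle formula \<open>(2 cos x)\<^sup>2 = 2 + 2 cos 2x\<close>.\<close>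

definition bounds_ok :: "bound_table \<Rightarrow> bool" where
  "bounds_ok t \<longleftrightarrow> t 0 = (131072, 131072) \<and> list_all (bound_ok t) [1..256]"

definition grid_angle :: "int \<Rightarrow> real" where
  "grid_angle i = of_int i * pi / 512"

text \<open>Every grid index arises from 0 by reflecting i to 512 - i and by halving even indices.
  The induction treats the multiples of \<open>2 ^ (9 - n)\<close>: those up to 256 come from their
  doubles, the others by reflection.\<close>

lemma cos_bounds:
  assumes t: "bounds_ok t" and i: "0 \<le> i" "i \<le> 512"
  shows "fst (cos_bounds t i) \<le> 65536 * (2 * cos (grid_angle i))"
    and "65536 * (2 * cos (grid_angle i)) \<le> snd (cos_bounds t i)"
proof -
  define good where "good i \<longleftrightarrow> fst (cos_bounds t i) \<le> 65536 * (2 * cos (grid_angle i)) \<and>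
    65536 * (2 * cos (grid_angle i)) \<le> snd (cos_bounds t i)" for i
  have reflect: "good (512 - i)" if "good i" "0 \<le> i" "i \<le> 255" for i
  proof -
    have "grid_angle (512 - i) = pi - grid_angle i" by (simp add: grid_angle_def field_simps)
    moreover have "cos_bounds t i = t i" using that by (simp add: cos_bounds_def)
    moreover have "cos_bounds t (512 - i) = (- snd (t i), - fst (t i))"
      using that by (cases "t i") (simp add: cos_bounds_def)
    ultimately show ?thesis using that(1) by (simp add: good_def)
  qed
  have good0: "good 0"
    using t by (simp add: good_def cos_bounds_def bounds_ok_def grid_angle_def)
  have half: "good i" if "good (2 * i)" "1 \<le> i" "i \<le> 256" for i
  proof -
    obtain a b where ab: "t i = (a, b)" by fastforce
    obtain a' b' where ab': "cos_bounds t (2 * i) = (a', b')" by fastforce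
    have chk: "0 \<le> a" "0 \<le> b" "a * a \<le> 65536 * (131072 + a')" "65536 * (131072 + b') \<le> b * b"
    proof -
      have "i \<in> set [1..256]" using that(2,3) by simp
      from bspec[OF t[unfolded bounds_ok_def list_all_iff, THEN conjunct2] this]
      show "0 \<le> a" "0 \<le> b" "a * a \<le> 65536 * (131072 + a')" "65536 * (131072 + b') \<le> b * b"
        by (simp_all add: ab ab' bound_ok_def)
    qed
    define x where "x = 65536 * (2 * cos (grid_angle i))"
    have ang: "grid_angle (2 * i) = 2 * grid_angle i" by (simp add: grid_angle_def)
    have "grid_angle i \<le> 256 * pi / 512"
      unfolding grid_angle_def using that(3) by (intro divide_right_mono mult_right_mono) auto
    then have "0 \<le> grid_angle i" "grid_angle i \<le> pi / 2"
      using that(2) by (simp_all add: grid_angle_def)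
    then have x0: "0 \<le> x" by (simp add: x_def cos_ge_zero)
    have x2: "x\<^sup>2 = 65536 * (131072 + 65536 * (2 * cos (grid_angle (2 * i))))"
      unfolding ang cos_double_cos x_def by (simp add: power2_eq_square algebra_simps)
    have g: "a' \<le> 65536 * (2 * cos (grid_angle (2 * i)))" "65536 * (2 * cos (grid_angle (2 * i))) \<le> b'"
      using that(1) ab' by (auto simp: good_def)
    have "real_of_int (a * a) \<le> of_int (65536 * (131072 + a'))" "real_of_int (65536 * (131072 + b')) \<le> of_int (b * b)"
      using chk by (simp_all only: of_int_le_iff)
    then have "(real_of_int a)\<^sup>2 \<le> x\<^sup>2" "x\<^sup>2 \<le> (real_of_int b)\<^sup>2"
      using g unfolding x2 by (simp_all add: power2_eq_square)
    then have "a \<le> x" "x \<le> b" using x0 chk by (auto intro: power2_le_imp_le)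
    then show ?thesis using that(3) ab by (simp add: good_def x_def cos_bounds_def)
  qed
  have "good i" if "2 ^ (9 - n) dvd i" "0 \<le> i" "i \<le> 512" "n \<le> 9" for i :: int and n :: nat
    using that
  proof (induction n arbitrary: i)
    case 0
    then obtain k where "i = 512 * k" by auto
    with 0 have "k = 0 \<or> k = 1" by auto
    then show ?case using good0 reflect[OF good0] \<open>i = 512 * k\<close> by auto
  next
    case (Suc n)
    have lower: "good j" if "2 ^ (9 - Suc n) dvd j" "0 \<le> j" "j \<le> 256" for j
    proof (cases "j = 0")
      case False
      have "9 - n = Suc (9 - Suc n)" using Suc.prems by simp
      then have "2 ^ (9 - n) dvd 2 * j" using that(1) by simp
      then show ?thesis using Suc.IH[of "2 * j"] half[of j] Suc.prems that False by auto
    qed (simp add: good0)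
    show ?case
    proof (cases "i \<le> 256")
      case False
      have "(512 :: int) = 2 ^ (9 - Suc n) * 2 ^ Suc n"
        using Suc.prems by (simp flip: power_add)
      then have "2 ^ (9 - Suc n) dvd (512 :: int)" by (rule dvdI)
      then have "2 ^ (9 - Suc n) dvd 512 - i" using Suc.prems by (simp add: dvd_diff)
      then show ?thesis using lower[of "512 - i"] reflect[of "512 - i"] False Suc.prems by simp
    qed (use lower Suc.prems in auto)
  qed
  from this[of 9 i] i show "fst (cos_bounds t i) \<le> 65536 * (2 * cos (grid_angle i))"
    "65536 * (2 * cos (grid_angle i)) \<le> snd (cos_bounds t i)" by (auto simp: good_def)
qed

text \<open>A box \<open>(i\<^sub>0, i\<^sub>1, j\<^sub>0, j\<^sub>1)\<close> is given in units of \<open>\<pi> / 512\<close>. All boxes lie in the half \<open>x < y\<close>; their mirror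
  images, which have the same coefficients, are counted as well.\<close>

type_synonym box = "int \<times> int \<times> int \<times> int"

text \<open>With u and v scaled by 2^16, both s and r are brought to scale 2^32: the sum takes
  another factor 65536, and the constant 2 in r becomes 8589934592.\<close>

definition corner_ok :: "int list \<Rightarrow> int \<Rightarrow> int \<Rightarrow> bool" where
  "corner_ok qs u v = int_coeffs_ok 4294967296 ((u + v) * 65536) (8589934592 + u * v) (qs @ [0, 0, 0]) 1 0 0 0"

definition corners_ok :: "int list \<Rightarrow> int \<Rightarrow> int \<Rightarrow> int \<Rightarrow> int \<Rightarrow> bool" where
  "corners_ok qs u0 u1 v0 v1 \<longleftrightarrow> corner_ok qs u0 v0 \<and> corner_ok qs u0 v1 \<and> corner_ok qs u1 v0 \<and> corner_ok qs u1 v1"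

text \<open>The cosine decreases on [0, \<pi>], so the larger grid index gives the lower bound of
  the trace.\<close>

fun box_ok :: "bound_table \<Rightarrow> int list \<Rightarrow> box \<Rightarrow> bool" where
  "box_ok t qs (i0, i1, j0, j1) \<longleftrightarrow>
    corners_ok qs (fst (cos_bounds t i1)) (snd (cos_bounds t i0)) (fst (cos_bounds t j1)) (snd (cos_bounds t j0))"

lemma corner_ok:
  assumes "corner_ok qs u v"
  shows "coeffs_ok (u / 65536 + v / 65536) (2 + u / 65536 * (v / 65536)) (1 / 4294967296) (qs @ [0, 0, 0]) 1 0 0 0"
proof -
  have eq: "real_of_int ((u + v) * 65536) / real_of_int 4294967296 = u / 65536 + v / 65536"
    "real_of_int (8589934592 + u * v) / real_of_int 4294967296 = 2 + u / 65536 * (v / 65536)"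
    by (simp_all add: field_simps)
  have "(4294967296 :: int) > 0" by simp
  from int_coeffs_ok[OF this assms[unfolded corner_ok_def]] show ?thesis
    unfolding eq unfolding of_int_numeral .
qed

lemma box_ok:
  assumes t: "bounds_ok t" and box: "box_ok t qs (i0, i1, j0, j1)"
    and i: "0 \<le> i0" "i1 \<le> 512" and j: "0 \<le> j0" "j1 \<le> 512"
    and x: "grid_angle i0 < x" "x < grid_angle i1" and y: "grid_angle j0 < y" "y < grid_angle j1"
  shows "coeffs_ok (2 * cos x + 2 * cos y) (2 + 2 * cos x * (2 * cos y)) (1 / 4294967296) (qs @ [0, 0, 0]) 1 0 0 0"
proof -
  have bd: "fst (cos_bounds t i1) / 65536 \<le> 2 * cos x" "2 * cos x \<le> snd (cos_bounds t i0) / 65536"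
    if "0 \<le> i0" "i1 \<le> 512" "grid_angle i0 < x" "x < grid_angle i1" for i0 i1 x
  proof -
    from that have "grid_angle i0 < grid_angle i1" by simp
    then have lt: "i0 < i1" by (simp add: grid_angle_def)
    have rng: "0 \<le> grid_angle k \<and> grid_angle k \<le> pi" if "0 \<le> k" "k \<le> 512" for k
      using that by (simp add: grid_angle_def)
    have "cos (grid_angle i1) \<le> cos x" "cos x \<le> cos (grid_angle i0)"
      using that lt rng[of i0] rng[of i1] by (auto intro!: cos_monotone_0_pi_le)
    then show "fst (cos_bounds t i1) / 65536 \<le> 2 * cos x" "2 * cos x \<le> snd (cos_bounds t i0) / 65536"
      using cos_bounds[OF t, of i1] cos_bounds[OF t, of i0] that lt by auto
  qed
  show ?thesis
    by (rule coeffs_ok_box[OF bd[OF i x] bd[OF j y]]; rule corner_ok) (use box in \<open>simp_all add: corners_ok_def\<close>)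
qed

section \<open>Densities of disjoint families of boxes\<close>

fun strips_ok :: "int \<Rightarrow> box list \<Rightarrow> bool" where
  "strips_ok k [] \<longleftrightarrow> True"
| "strips_ok k ((i0, i1, j0, j1) # bs) \<longleftrightarrow>
    k \<le> i0 \<and> i0 < i1 \<and> i1 \<le> j0 \<and> j0 < j1 \<and> j1 \<le> 512 \<and> strips_ok i1 bs"

fun area :: "box list \<Rightarrow> int" where
  "area [] = 0"
| "area ((i0, i1, j0, j1) # bs) = (i1 - i0) * (j1 - j0) + area bs"

definition in_box :: "real \<Rightarrow> real \<Rightarrow> box \<Rightarrow> bool" where
  "in_box x y = (\<lambda>(i0, i1, j0, j1). grid_angle i0 < x \<and> x < grid_angle i1 \<and> grid_angle j0 < y \<and> y < grid_angle j1)"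

definition strip_hits :: "real \<Rightarrow> real \<Rightarrow> box list \<Rightarrow> nat set" where
  "strip_hits \<alpha> \<beta> bs = {m. \<exists>b\<in>set bs. in_box (fold_angle (real m * \<alpha>)) (fold_angle (real m * \<beta>)) b}"

lemma strips_okD:
  assumes "strips_ok k bs" "(i0, i1, j0, j1) \<in> set bs"
  shows "k \<le> i0 \<and> i0 < i1 \<and> i1 \<le> j0 \<and> j0 < j1 \<and> j1 \<le> 512"
  using assms by (induction k bs rule: strips_ok.induct) fastforce+

lemma grid_angle_mono: "i \<le> j \<Longrightarrow> grid_angle i \<le> grid_angle j"
  by (simp add: grid_angle_def)

text \<open>The boxes occupy consecutive intervals of the first angle, so they are disjoint and
  their densities add. A grid cell has normalised measure 1/262144, where 262144 = 512^2.\<close>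

lemma lower_density_strips:
  assumes ind: "\<And>k l :: nat. k > 0 \<or> l > 0 \<Longrightarrow> cos (real k * \<alpha>) \<noteq> cos (real l * \<beta>)"
    and "strips_ok k bs" "0 \<le> k"
  shows "lower_density_ge (strip_hits \<alpha> \<beta> bs) (area bs / 262144)"
  using assms(2,3)
proof (induction k bs rule: strips_ok.induct)
  case (1 k)
  then show ?case using lower_density_ge_empty by (simp add: strip_hits_def)
next
  case (2 k i0 i1 j0 j1 bs)
  have ord: "0 \<le> i0" "i0 < i1" "i1 \<le> 512" "0 \<le> j0" "j0 < j1" "j1 \<le> 512" using 2(2,3) by auto
  have dens: "lower_density_ge (strip_hits \<alpha> \<beta> [(i0, i1, j0, j1)])
    ((grid_angle i1 - grid_angle i0) / pi * ((grid_angle j1 - grid_angle j0) / pi))"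
  proof -
    have eq: "strip_hits \<alpha> \<beta> [(i0, i1, j0, j1)] = {m. grid_angle i0 < fold_angle (real m * \<alpha>) \<and> fold_angle (real m * \<alpha>) < grid_angle i1 \<and>
      grid_angle j0 < fold_angle (real m * \<beta>) \<and> fold_angle (real m * \<beta>) < grid_angle j1}"
      by (simp add: strip_hits_def in_box_def)
    show ?thesis unfolding eq using ord by (intro lower_density_box ind) (auto simp: grid_angle_def)
  qed
  have disj: "strip_hits \<alpha> \<beta> [(i0, i1, j0, j1)] \<inter> strip_hits \<alpha> \<beta> bs = {}"
  proof -
    have "grid_angle i1 < x" if "b \<in> set bs" "in_box x y b" for x y b
    proof -
      obtain i0' i1' j0' j1' where b: "b = (i0', i1', j0', j1')" by (cases b)
      have "i1 \<le> i0'" using strips_okD[of i1 bs] 2(2) that(1) b by auto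
      then show ?thesis using that(2) grid_angle_mono[of i1 i0'] by (simp add: in_box_def b)
    qed
    then show ?thesis by (fastforce simp: strip_hits_def in_box_def)
  qed
  have "lower_density_ge (strip_hits \<alpha> \<beta> [(i0, i1, j0, j1)] \<union> strip_hits \<alpha> \<beta> bs)
    ((grid_angle i1 - grid_angle i0) / pi * ((grid_angle j1 - grid_angle j0) / pi) + area bs / 262144)"
    using 2 by (intro lower_density_ge_Un dens disj 2(1)) auto
  moreover have "strip_hits \<alpha> \<beta> [(i0, i1, j0, j1)] \<union> strip_hits \<alpha> \<beta> bs = strip_hits \<alpha> \<beta> ((i0, i1, j0, j1) # bs)"
    by (auto simp: strip_hits_def)
  moreover have "(grid_angle i1 - grid_angle i0) / pi * ((grid_angle j1 - grid_angle j0) / pi) + area bs / 262144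
    = area ((i0, i1, j0, j1) # bs) / 262144"
  proof -
    have r: "(grid_angle i - grid_angle j) / pi = of_int (i - j) / 512" for i j
      by (simp add: grid_angle_def diff_divide_distrib)
    show ?thesis unfolding r by (simp add: add_divide_distrib)
  qed
  ultimately show ?case by (simp only:)
qed

type_synonym entry = "int list \<times> box list"

fun entry_ok :: "bound_table \<Rightarrow> entry \<Rightarrow> bool" where
  "entry_ok t (qs, bs) \<longleftrightarrow> strips_ok 0 bs \<and> last (1 # qs) = 1 \<and> \<not> has_three_zeros qs \<and> list_all (box_ok t qs) bs"

definition entry_hits :: "real \<Rightarrow> real \<Rightarrow> entry \<Rightarrow> nat set" where
  "entry_hits \<alpha> \<beta> e = strip_hits \<alpha> \<beta> (snd e) \<union> strip_hits \<beta> \<alpha> (snd e)"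

lemma entry_hits_coeffs_ok:
  assumes t: "bounds_ok t" and e: "entry_ok t (qs, bs)" and m: "m \<in> entry_hits \<alpha> \<beta> (qs, bs)"
  shows "coeffs_ok (2 * cos (real m * \<alpha>) + 2 * cos (real m * \<beta>)) (2 + 2 * cos (real m * \<alpha>) * (2 * cos (real m * \<beta>)))
    (1 / 4294967296) (qs @ [0, 0, 0]) 1 0 0 0"
proof -
  have fold: "cos (fold_angle x) = cos x" for x by (simp add: fold_angle_def cos_arccos)
  have *: "coeffs_ok (2 * cos x + 2 * cos y) (2 + 2 * cos x * (2 * cos y)) (1 / 4294967296) (qs @ [0, 0, 0]) 1 0 0 0"
    if b: "b \<in> set bs" "in_box (fold_angle x) (fold_angle y) b" for x y b
  proof -
    obtain i0 i1 j0 j1 where beq: "b = (i0, i1, j0, j1)" by (cases b)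
    have "box_ok t qs (i0, i1, j0, j1)" using e b beq by (auto simp: list_all_iff)
    moreover have "0 \<le> i0 \<and> i0 < i1 \<and> i1 \<le> j0 \<and> j0 < j1 \<and> j1 \<le> 512"
      using e b beq strips_okD[of 0 bs] by simp
    ultimately show ?thesis
      using box_ok[OF t, of qs i0 i1 j0 j1 "fold_angle x" "fold_angle y"] b(2) by (simp add: in_box_def beq fold)
  qed
  from m consider b where "b \<in> set bs" "in_box (fold_angle (real m * \<alpha>)) (fold_angle (real m * \<beta>)) b"
    | b where "b \<in> set bs" "in_box (fold_angle (real m * \<beta>)) (fold_angle (real m * \<alpha>)) b"
    by (auto simp: entry_hits_def strip_hits_def)
  then show ?thesis
    by cases (use * in blast, metis * add.commute mult.commute)
qed

text \<open>Every box lies strictly on one side of the diagonal, so the boxes and their mirror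
  images are disjoint and the density doubles.\<close>

lemma lower_density_entry:
  assumes ind: "\<And>k l :: nat. k > 0 \<or> l > 0 \<Longrightarrow> cos (real k * \<alpha>) \<noteq> cos (real l * \<beta>)"
    and e: "entry_ok t (qs, bs)"
  shows "lower_density_ge (entry_hits \<alpha> \<beta> (qs, bs)) (2 * area bs / 262144)"
proof -
  have lt: "x < y" if "b \<in> set bs" "in_box x y b" for x y b
  proof -
    obtain i0 i1 j0 j1 where b: "b = (i0, i1, j0, j1)" by (cases b)
    have "i1 \<le> j0" using strips_okD[of 0 bs] e that(1) b by auto
    then show ?thesis using that(2) grid_angle_mono[of i1 j0] by (simp add: in_box_def b)
  qed
  have "strip_hits \<alpha> \<beta> bs \<inter> strip_hits \<beta> \<alpha> bs = {}"
  proof (rule ccontr)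
    assume "\<not> ?thesis"
    then obtain m b b' where "b \<in> set bs" "in_box (fold_angle (real m * \<alpha>)) (fold_angle (real m * \<beta>)) b"
      "b' \<in> set bs" "in_box (fold_angle (real m * \<beta>)) (fold_angle (real m * \<alpha>)) b'"
      unfolding strip_hits_def by blast
    from lt[OF this(1,2)] lt[OF this(3,4)] show False by simp
  qed
  moreover have "lower_density_ge (strip_hits \<alpha> \<beta> bs) (area bs / 262144)"
    using e by (intro lower_density_strips[where k = 0] ind) auto
  moreover have "lower_density_ge (strip_hits \<beta> \<alpha> bs) (area bs / 262144)"
    using e ind by (intro lower_density_strips[where k = 0]) (auto dest: sym)
  ultimately show ?thesis
    using lower_density_ge_Un by (fastforce simp: entry_hits_def)
qed

text \<open>An index m counted for two entries would satisfy the coefficient conditions for both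
  multipliers, which then agree by \<open>coeffs_ok_unique\<close>, against \<open>distinct\<close>.
  So boxes of different entries need no geometric comparison.\<close>

lemma lower_density_cert:
  assumes ind: "\<And>k l :: nat. k > 0 \<or> l > 0 \<Longrightarrow> cos (real k * \<alpha>) \<noteq> cos (real l * \<beta>)"
    and t: "bounds_ok t" and c: "list_all (entry_ok t) cert" "distinct (map fst cert)"
  shows "lower_density_ge (\<Union>e\<in>set cert. entry_hits \<alpha> \<beta> e) (2 * (\<Sum>e\<leftarrow>cert. area (snd e)) / 262144)"
  using c
proof (induction cert)
  case Nil
  then show ?case using lower_density_ge_empty by simp
next
  case (Cons e cert)
  obtain qs bs where e: "e = (qs, bs)" by (cases e)
  have "entry_hits \<alpha> \<beta> e \<inter> (\<Union>e\<in>set cert. entry_hits \<alpha> \<beta> e) = {}"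
  proof (rule ccontr)
    assume "\<not> ?thesis"
    then obtain m e' where m: "m \<in> entry_hits \<alpha> \<beta> e" "e' \<in> set cert" "m \<in> entry_hits \<alpha> \<beta> e'" by blast
    obtain qs' bs' where e': "e' = (qs', bs')" by (cases e')
    have ok: "entry_ok t (qs, bs)" "entry_ok t (qs', bs')"
      using Cons.prems m(2) e e' by (auto simp: list_all_iff simp del: entry_ok.simps)
    have "m \<in> entry_hits \<alpha> \<beta> (qs, bs)" "m \<in> entry_hits \<alpha> \<beta> (qs', bs')" using m e e' by simp_all
    note hits = entry_hits_coeffs_ok[OF t ok(1) this(1)] entry_hits_coeffs_ok[OF t ok(2) this(2)]
    have "qs = qs'"
      by (rule coeffs_ok_unique[OF _ hits(1) _ _ hits(2)]) (simp, (use ok[unfolded entry_ok.simps] in blast)+)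
    then have "fst e \<in> fst ` set cert" using m(2) e e' by force
    then show False using Cons.prems by simp
  qed
  moreover have "lower_density_ge (entry_hits \<alpha> \<beta> e) (2 * area (snd e) / 262144)"
    using lower_density_entry[OF ind] Cons.prems e by auto
  ultimately have "lower_density_ge (entry_hits \<alpha> \<beta> e \<union> (\<Union>e\<in>set cert. entry_hits \<alpha> \<beta> e))
    (2 * area (snd e) / 262144 + 2 * (\<Sum>e\<leftarrow>cert. area (snd e)) / 262144)"
    using Cons by (intro lower_density_ge_Un) auto
  then show ?case by (simp add: add_divide_distrib distrib_left)
qed

lemma liminf_gt_half:
  assumes "lower_density_ge X a" "a > 1 / 2"
  shows "liminf (\<lambda>M. ereal (real (card (X \<inter> {1..M})) / real M)) > ereal (1 / 2)"
proof -
  \<comment> \<open>The midpoint of 1/2 and a: the eventual lower bound c keeps the strict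
    inequality in the limit.\<close>
  define c where "c = a / 2 + 1 / 4"
  have c: "1 / 2 < c \<and> c < a" using assms(2) by (simp add: c_def)
  have "\<forall>\<^sub>F M in sequentially. a - (a - c) \<le> real (card (X \<inter> {1..M})) / real M"
    using assms(1) c unfolding lower_density_ge_def by (metis diff_gt_0_iff_gt)
  then have "\<forall>\<^sub>F M in sequentially. ereal c \<le> ereal (real (card (X \<inter> {1..M})) / real M)"
    by eventually_elim simp
  then have "ereal c \<le> liminf (\<lambda>M. ereal (real (card (X \<inter> {1..M})) / real M))"
    by (rule Liminf_bounded)
  then show ?thesis using c less_le_trans[of "ereal (1 / 2)" "ereal c"] by simp
qed

text \<open>In \<open>big\<close> one factor 2 accounts for the mirror images and the other for the
  bound 1/2.\<close>

lemma density_from_certificate: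
  fixes beta :: real
  assumes s: "salem_number_deg 6 beta"
    and t: "bounds_ok t" and c: "list_all (entry_ok t) cert" "distinct (map fst cert)"
    and big: "4 * (\<Sum>e\<leftarrow>cert. area (snd e)) > 262144"
  shows "liminf (\<lambda>M::nat. ereal (real (card {m \<in> {1..M}. \<exists>p. mp_periodic (beta_exp_one (beta ^ m)) 1 p}) / real M))
           > ereal (1/2)"
proof -
  define Y where "Y = {m. \<exists>p. mp_periodic (beta_exp_one (beta ^ m)) 1 p}"
  have \<beta>: "beta > 1" using s by (simp add: salem_number_deg_def)
  obtain \<theta> \<phi> where ind: "\<And>k l :: nat. k > 0 \<or> l > 0 \<Longrightarrow> cos (real k * \<theta>) \<noteq> cos (real l * \<phi>)"
    and tr: "\<And>m t u v. t = beta ^ m + 1 / beta ^ m \<Longrightarrow> u = 2 * cos (real m * \<theta>) \<Longrightarrow> v = 2 * cos (real m * \<phi>) \<Longrightarrow>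
      t + (u + v) \<in> \<int> \<and> t * (u + v) + (2 + u * v) \<in> \<int> \<and> t * (2 + u * v) + 2 * (u + v) \<in> \<int>"
    using salem6_power_traces[OF s] by blast
  \<comment> \<open>From this exponent on, \<open>1 / beta ^ m\<close> is below 2^-32, the margin
    left by the integer checks.\<close>
  obtain m0 where m0: "beta ^ m0 > 4294967296" using real_arch_pow[OF \<beta>] by blast
  have "m \<in> Y" if m: "m \<in> (\<Union>e\<in>set cert. entry_hits \<theta> \<phi> e)" "m0 \<le> m" for m
  proof -
    from m obtain qs bs where e: "(qs, bs) \<in> set cert" "m \<in> entry_hits \<theta> \<phi> (qs, bs)" by fastforce
    then have ok: "entry_ok t (qs, bs)" using c by (auto simp: list_all_iff simp del: entry_ok.simps)
    have "beta ^ m0 \<le> beta ^ m" using \<beta> m(2) by (simp add: power_increasing)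
    then have B: "beta ^ m > 4294967296" using m0 by linarith
    then have "1 / beta ^ m < 1 / 4294967296" by (simp add: field_simps)
    moreover have "1 < beta ^ m" using B by linarith
    moreover have "last (1 # qs) = 1" using ok by (simp only: entry_ok.simps)
    ultimately have "\<exists>p. mp_periodic (beta_exp_one (beta ^ m)) 1 p"
      using mp_periodic_of_coeffs_ok[OF _ _ refl _ _ _ entry_hits_coeffs_ok[OF t ok e(2)]] tr[OF refl refl refl, of m]
      by blast
    then show ?thesis by (simp add: Y_def)
  qed
  then have "lower_density_ge Y (2 * (\<Sum>e\<leftarrow>cert. area (snd e)) / 262144)"
    using lower_density_ge_mono[OF lower_density_cert[OF ind t c]] by blast
  moreover have "2 * (\<Sum>e\<leftarrow>cert. area (snd e)) / 262144 > (1 / 2 :: real)"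
    using big by linarith
  ultimately have "liminf (\<lambda>M. ereal (real (card (Y \<inter> {1..M})) / real M)) > ereal (1 / 2)"
    by (rule liminf_gt_half)
  moreover have "{m \<in> {1..M}. \<exists>p. mp_periodic (beta_exp_one (beta ^ m)) 1 p} = Y \<inter> {1..M}" for M
    by (auto simp: Y_def)
  ultimately show ?thesis by simp
qed

subsection \<open>The certificate\<close>

text \<open>Nested comparisons form a search tree, so the simplifier resolves a lookup in about
  eight steps. The origin of the numbers is immaterial, since \<open>bounds_ok\<close> certifies
  them.\<close>

definition cos_table0 :: bound_table where
  "cos_table0 i = (
    if i < 8 then (if i < 4 then (if i < 2 then (if i < 1 then (131072, 131072) else (131069, 131070)) else
    if i < 3 then (131061, 131063) else (131049, 131050)) else if i < 6 then (if i < 5 then (131032, 131033)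
    else (131010, 131011)) else if i < 7 then (130982, 130984) else (130950, 130952)) else if i < 12 then (if
    i < 10 then (if i < 9 then (130913, 130915) else (130872, 130873)) else if i < 11 then (130825, 130826)
    else (130773, 130774)) else if i < 14 then (if i < 13 then (130716, 130718) else (130655, 130656)) else
    if i < 15 then (130588, 130589) else (130517, 130518))"

definition cos_table1 :: bound_table where
  "cos_table1 i = (
    if i < 24 then (if i < 20 then (if i < 18 then (if i < 17 then (130440, 130441) else (130359, 130360))
    else if i < 19 then (130273, 130274) else (130182, 130183)) else if i < 22 then (if i < 21 then (130086,
    130087) else (129985, 129986)) else if i < 23 then (129879, 129880) else (129768, 129770)) else if i < 28
    then (if i < 26 then (if i < 25 then (129653, 129654) else (129532, 129533)) else if i < 27 then (129407,
    129408) else (129277, 129278)) else if i < 30 then (if i < 29 then (129142, 129143) else (129002,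
    129003)) else if i < 31 then (128857, 128858) else (128707, 128709))"

definition cos_table2 :: bound_table where
  "cos_table2 i = (
    if i < 40 then (if i < 36 then (if i < 34 then (if i < 33 then (128553, 128554) else (128393, 128395))
    else if i < 35 then (128229, 128231) else (128060, 128062)) else if i < 38 then (if i < 37 then (127887,
    127888) else (127708, 127709)) else if i < 39 then (127525, 127526) else (127336, 127338)) else if i < 44
    then (if i < 42 then (if i < 41 then (127143, 127145) else (126945, 126947)) else if i < 43 then (126743,
    126744) else (126536, 126537)) else if i < 46 then (if i < 45 then (126323, 126325) else (126106,
    126108)) else if i < 47 then (125885, 125886) else (125658, 125660))"

definition cos_table3 :: bound_table where
  "cos_table3 i = (
    if i < 56 then (if i < 52 then (if i < 50 then (if i < 49 then (125427, 125429) else (125192, 125193))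
    else if i < 51 then (124951, 124952) else (124706, 124707)) else if i < 54 then (if i < 53 then (124456,
    124457) else (124201, 124203)) else if i < 55 then (123942, 123943) else (123678, 123680)) else if i < 60
    then (if i < 58 then (if i < 57 then (123409, 123411) else (123136, 123138)) else if i < 59 then (122858,
    122860) else (122575, 122577)) else if i < 62 then (if i < 61 then (122288, 122290) else (121997,
    121998)) else if i < 63 then (121701, 121702) else (121399, 121402))"

definition cos_table4 :: bound_table where
  "cos_table4 i = (
    if i < 72 then (if i < 68 then (if i < 66 then (if i < 65 then (121094, 121095) else (120783, 120786))
    else if i < 67 then (120469, 120471) else (120150, 120152)) else if i < 70 then (if i < 69 then (119826,
    119828) else (119498, 119500)) else if i < 71 then (119166, 119167) else (118828, 118830)) else if i < 76
    then (if i < 74 then (if i < 73 then (118487, 118488) else (118141, 118142)) else if i < 75 then (117790,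
    117792) else (117435, 117437)) else if i < 78 then (if i < 77 then (117076, 117077) else (116712,
    116714)) else if i < 79 then (116344, 116345) else (115971, 115973))"

definition cos_table5 :: bound_table where
  "cos_table5 i = (
    if i < 88 then (if i < 84 then (if i < 82 then (if i < 81 then (115594, 115596) else (115213, 115215))
    else if i < 83 then (114827, 114829) else (114438, 114439)) else if i < 86 then (if i < 85 then (114043,
    114045) else (113645, 113646)) else if i < 87 then (113242, 113243) else (112835, 112836)) else if i < 92
    then (if i < 90 then (if i < 89 then (112423, 112425) else (112008, 112009)) else if i < 91 then (111588,
    111589) else (111164, 111166)) else if i < 94 then (if i < 93 then (110736, 110738) else (110303,
    110305)) else if i < 95 then (109867, 109869) else (109426, 109428))"

definition cos_table6 :: bound_table where
  "cos_table6 i = (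
    if i < 104 then (if i < 100 then (if i < 98 then (if i < 97 then (108982, 108983) else (108532, 108534))
    else if i < 99 then (108080, 108081) else (107623, 107624)) else if i < 102 then (if i < 101 then
    (107162, 107163) else (106697, 106698)) else if i < 103 then (106227, 106229) else (105754, 105756)) else
    if i < 108 then (if i < 106 then (if i < 105 then (105277, 105279) else (104796, 104798)) else if i < 107
    then (104311, 104313) else (103822, 103824)) else if i < 110 then (if i < 109 then (103329, 103331) else
    (102833, 102834)) else if i < 111 then (102332, 102334) else (101827, 101830))"

definition cos_table7 :: bound_table where
  "cos_table7 i = (
    if i < 120 then (if i < 116 then (if i < 114 then (if i < 113 then (101319, 101321) else (100807,
    100809)) else if i < 115 then (100291, 100293) else (99772, 99773)) else if i < 118 then (if i < 117 then
    (99248, 99250) else (98721, 98723)) else if i < 119 then (98189, 98192) else (97655, 97657)) else if i <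
    124 then (if i < 122 then (if i < 121 then (97117, 97119) else (96575, 96577)) else if i < 123 then
    (96029, 96032) else (95480, 95482)) else if i < 126 then (if i < 125 then (94928, 94931) else (94369,
    94375)) else if i < 127 then (93808, 93817) else (93245, 93253))"

definition cos_table8 :: bound_table where
  "cos_table8 i = (
    if i < 136 then (if i < 132 then (if i < 130 then (if i < 129 then (92681, 92682) else (92107, 92116))
    else if i < 131 then (91533, 91542) else (90957, 90964)) else if i < 134 then (if i < 133 then (90377,
    90380) else (89794, 89797)) else if i < 135 then (89207, 89209) else (88616, 88618)) else if i < 140 then
    (if i < 138 then (if i < 137 then (88021, 88024) else (87424, 87426)) else if i < 139 then (86823, 86826)
    else (86219, 86221)) else if i < 142 then (if i < 141 then (85611, 85614) else (85001, 85003)) else if i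
    < 143 then (84387, 84390) else (83770, 83772))"

definition cos_table9 :: bound_table where
  "cos_table9 i = (
    if i < 152 then (if i < 148 then (if i < 146 then (if i < 145 then (83150, 83152) else (82526, 82529))
    else if i < 147 then (81901, 81902) else (81271, 81273)) else if i < 150 then (if i < 149 then (80638,
    80640) else (80003, 80005)) else if i < 151 then (79364, 79367) else (78723, 78725)) else if i < 156 then
    (if i < 154 then (if i < 153 then (78079, 78080) else (77431, 77433)) else if i < 155 then (76781, 76783)
    else (76128, 76129)) else if i < 158 then (if i < 157 then (75471, 75473) else (74812, 74814)) else if i
    < 159 then (74151, 74153) else (73486, 73489))"

definition cos_table10 :: bound_table where
  "cos_table10 i = (
    if i < 168 then (if i < 164 then (if i < 162 then (if i < 161 then (72819, 72820) else (72148, 72151))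
    else if i < 163 then (71476, 71478) else (70800, 70802)) else if i < 166 then (if i < 165 then (70122,
    70124) else (69441, 69443)) else if i < 167 then (68758, 68760) else (68072, 68074)) else if i < 172 then
    (if i < 170 then (if i < 169 then (67383, 67385) else (66692, 66694)) else if i < 171 then (65999, 66001)
    else (65303, 65305)) else if i < 174 then (if i < 173 then (64604, 64606) else (63903, 63905)) else if i
    < 175 then (63200, 63202) else (62494, 62496))"

definition cos_table11 :: bound_table where
  "cos_table11 i = (
    if i < 184 then (if i < 180 then (if i < 178 then (if i < 177 then (61786, 61788) else (61075, 61077))
    else if i < 179 then (60363, 60365) else (59648, 59650)) else if i < 182 then (if i < 181 then (58931,
    58932) else (58211, 58213)) else if i < 183 then (57490, 57492) else (56766, 56767)) else if i < 188 then
    (if i < 186 then (if i < 185 then (56040, 56042) else (55311, 55314)) else if i < 187 then (54581, 54584)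
    else (53848, 53851)) else if i < 190 then (if i < 189 then (53114, 53117) else (52378, 52381)) else if i
    < 191 then (51640, 51643) else (50898, 50905))"

definition cos_table12 :: bound_table where
  "cos_table12 i = (
    if i < 200 then (if i < 196 then (if i < 194 then (if i < 193 then (50159, 50160) else (49411, 49418))
    else if i < 195 then (48667, 48670) else (47920, 47923)) else if i < 198 then (if i < 197 then (47171,
    47173) else (46420, 46423)) else if i < 199 then (45667, 45669) else (44912, 44914)) else if i < 204 then
    (if i < 202 then (if i < 201 then (44156, 44158) else (43397, 43400)) else if i < 203 then (42638, 42640)
    else (41876, 41879)) else if i < 206 then (if i < 205 then (41114, 41116) else (40349, 40352)) else if i
    < 207 then (39584, 39585) else (38816, 38818))"

definition cos_table13 :: bound_table where
  "cos_table13 i = (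
    if i < 216 then (if i < 212 then (if i < 210 then (if i < 209 then (38047, 38049) else (37276, 37279))
    else if i < 211 then (36504, 36507) else (35732, 35734)) else if i < 214 then (if i < 213 then (34957,
    34960) else (34182, 34184)) else if i < 215 then (33404, 33407) else (32626, 32629)) else if i < 220 then
    (if i < 218 then (if i < 217 then (31847, 31850) else (31066, 31068)) else if i < 219 then (30284, 30287)
    else (29501, 29504)) else if i < 222 then (if i < 221 then (28717, 28719) else (27932, 27934)) else if i
    < 223 then (27145, 27149) else (26358, 26361))"

definition cos_table14 :: bound_table where
  "cos_table14 i = (
    if i < 232 then (if i < 228 then (if i < 226 then (if i < 225 then (25570, 25572) else (24780, 24782))
    else if i < 227 then (23990, 23994) else (23198, 23202)) else if i < 230 then (if i < 229 then (22406,
    22410) else (21614, 21617)) else if i < 231 then (20821, 20823) else (20026, 20029)) else if i < 236 then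
    (if i < 234 then (if i < 233 then (19230, 19235) else (18435, 18438)) else if i < 235 then (17638, 17642)
    else (16841, 16844)) else if i < 238 then (if i < 237 then (16042, 16047) else (15244, 15247)) else if i
    < 239 then (14445, 14448) else (13645, 13650))"

text \<open>Near index 256 the trace is close to 0, and the square root in the half-angle formula
  magnifies rounding errors; hence the wider intervals there.\<close>

definition cos_table15 :: bound_table where
  "cos_table15 i = (
    if i < 248 then (if i < 244 then (if i < 242 then (if i < 241 then (12845, 12849) else (12045, 12049))
    else if i < 243 then (11243, 11247) else (10442, 10446)) else if i < 246 then (if i < 245 then (9640,
    9644) else (8838, 8843)) else if i < 247 then (8034, 8039) else (7231, 7237)) else if i < 252 then (if i
    < 250 then (if i < 249 then (6430, 6436) else (5626, 5632)) else if i < 251 then (4816, 4831) else (4015,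
    4024)) else if i < 254 then (if i < 253 then (3207, 3229) else (2401, 2429)) else if i < 255 then (1598,
    1620) else if i < 256 then (768, 850) else (0, 0))"

definition cos_table :: bound_table where
  "cos_table i = (
    if i < 128 then (if i < 64 then (if i < 32 then (if i < 16 then cos_table0 i else cos_table1 i) else if i
    < 48 then cos_table2 i else cos_table3 i) else if i < 96 then (if i < 80 then cos_table4 i else
    cos_table5 i) else if i < 112 then cos_table6 i else cos_table7 i) else if i < 192 then (if i < 160 then
    (if i < 144 then cos_table8 i else cos_table9 i) else if i < 176 then cos_table10 i else cos_table11 i)
    else if i < 224 then (if i < 208 then cos_table12 i else cos_table13 i) else if i < 240 then cos_table14
    i else cos_table15 i)"

lemma bounds_ok_cos_table: "bounds_ok cos_table"
  by code_simp

text \<open>Each entry consists of the coefficients of a multiplier \<open>Q\<close> without the leading one, found by running the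
  greedy expansion at sample points \<open>(u, v)\<close>, and of boxes inside its region.\<close>

definition certificate1 :: "entry list" where
  "certificate1 =
  [([3, 4, 4, 4, 4, 3, 1], [(63, 67, 231, 242)]), ([1, 1, 2, 2, 2, 3, 3, 2, 2, 2, 1, 1, 1], [(58, 62, 330,
  341)]), ([1, 1, 2, 2, 2, 3, 3, 3, 3, 2, 2, 2, 1, 1, 1], [(55, 57, 338, 353)]), ([0, 2, 0, 3, 0, 4, 0, 5, 0,
  5, 0, 4, 0, 3, 0, 2, 0, 1], [(50, 53, 489, 498)]), ([3, 5, 6, 6, 6, 7, 9, 11, 12, 12, 12, 12, 11, 9, 7, 6,
  6, 6, 5, 3, 1], [(46, 49, 176, 186)]), ([3, 5, 6, 5, 2, -1, -2, -1, 1, 3, 4, 4, 4, 4, 3, 1, -1, -2, -1, 2,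
  5, 6, 5, 3, 1], [(87, 93, 161, 170)]), ([], [(131, 134, 382, 387), (134, 137, 379, 390), (137, 140, 376,
  394), (140, 143, 373, 398), (143, 146, 370, 402), (146, 149, 367, 407), (149, 152, 364, 412), (152, 154,
  361, 418), (154, 156, 359, 422), (156, 158, 357, 427), (158, 160, 355, 432), (160, 162, 353, 438), (162,
  165, 351, 445), (165, 167, 348, 457), (167, 169, 346, 467), (169, 170, 344, 481), (170, 172, 343, 492),
  (172, 174, 345, 481), (174, 176, 348, 472), (176, 178, 350, 466), (178, 180, 353, 460), (180, 182, 355,
  454), (182, 184, 358, 449), (184, 186, 361, 444), (186, 188, 365, 440), (188, 191, 370, 434), (191, 193,
  375, 430), (193, 195, 379, 426), (195, 198, 387, 421), (198, 200, 393, 417), (200, 202, 399, 414)]), ([1],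
  [(106, 110, 305, 313), (110, 113, 303, 321), (113, 116, 301, 328), (116, 119, 299, 336), (119, 121, 297,
  345), (121, 123, 295, 352), (123, 125, 294, 359), (125, 127, 293, 368), (127, 133, 291, 378), (133, 135,
  287, 376), (135, 139, 285, 372), (139, 144, 282, 367), (144, 148, 278, 363), (148, 152, 275, 359), (152,
  156, 272, 355), (156, 159, 269, 352), (159, 163, 266, 348), (163, 167, 263, 344), (167, 170, 260, 341)]),
  ([-2, 2, -1, 1, -1, 0, 2, -3, 3, -3, 4, -4, 3, -2, 2, -1, -1, 3, -3, 3, -4, 5, -4, 3, -3, 3, -1, -1, 2, -2,
  3, -4, 4, -3, 3, -3, 2, 0, -1, 1, -1, 2, -2, 1], [(264, 269, 462, 473)]), ([0, 1], [(89, 92, 424, 430),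
  (92, 96, 421, 434), (96, 100, 417, 439), (100, 103, 413, 445), (103, 106, 410, 450), (106, 109, 407, 456),
  (109, 112, 404, 463), (112, 114, 401, 472), (114, 116, 399, 479), (116, 120, 397, 489), (120, 123, 393,
  478), (123, 126, 390, 469), (126, 130, 387, 459), (130, 133, 390, 452), (133, 136, 393, 447), (136, 139,
  397, 441), (139, 142, 401, 436), (142, 145, 406, 431), (145, 148, 411, 426), (148, 150, 415, 423)]), ([2,
  1, -2, -3, 1, 5, 3, -3, -5, 0, 5, 4, -1, -4, -2, 2, 4, 2, -2, -4, -1, 4, 5, 0, -5, -3, 3, 5, 1, -3, -2, 1,
  2, 1], [(171, 178, 217, 244), (178, 184, 220, 235)]), ([0, 2, 0, 2, 0, 1], [(63, 66, 450, 457), (66, 70,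
  447, 461), (70, 73, 443, 467), (73, 76, 440, 472), (76, 79, 437, 479), (79, 81, 434, 487), (81, 84, 432,
  495), (84, 87, 429, 484), (87, 91, 433, 474), (91, 94, 437, 467), (94, 97, 441, 461), (97, 100, 446,
  456)]), ([-1, 1, -1, 1], [(172, 174, 493, 511), (174, 176, 482, 511), (176, 179, 473, 511), (179, 182, 463,
  511), (182, 186, 455, 511), (186, 190, 445, 511), (190, 194, 437, 511), (194, 197, 429, 511), (197, 201,
  423, 511), (201, 214, 416, 511), (214, 219, 420, 511), (219, 224, 425, 511), (224, 229, 430, 511), (229,
  233, 435, 511), (233, 237, 441, 511), (237, 241, 448, 511), (241, 245, 456, 511), (245, 248, 464, 511),
  (248, 251, 473, 511), (251, 253, 482, 511), (253, 255, 495, 511)])]"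

lemma certificate1_ok: "list_all (entry_ok cos_table) certificate1"
  by code_simp

definition certificate2 :: "entry list" where
  "certificate2 =
  [([3, 4, 3, 2, 3, 4, 3, 1], [(68, 73, 220, 230)]), ([4, 9, 15, 21, 26, 29, 29, 26, 21, 15, 9, 4, 1], [(51,
  55, 103, 110)]), ([0, 2, 0, 2, -1, 2, -2, 2, -2, 2, -1, 2, 0, 2, 0, 1], [(84, 93, 496, 511)]), ([1, 1, 2,
  2, 2, 3, 3, 3, 4, 3, 3, 3, 2, 2, 2, 1, 1, 1], [(50, 53, 347, 358)]), ([2, 2, 2, 3, 3, 1, 0, 1, 1, -1, -1,
  1, 1, 0, 1, 3, 3, 2, 2, 2, 1], [(76, 79, 257, 269)]), ([2, 1], [(106, 108, 293, 303), (108, 110, 286, 302),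
  (110, 113, 279, 300), (113, 116, 270, 298), (116, 121, 261, 294), (121, 123, 264, 293), (123, 126, 269,
  291), (126, 129, 276, 289), (129, 131, 280, 287)]), ([-2, 2, -1, 1, -1, 0, 2, -3, 3, -2, 1, 0, -1, 3, -4,
  3, -1, 0, 1, -2, 3, -3, 2, 0, -1, 1, -1, 2, -2, 1], [(278, 293, 428, 443)]), ([0, 2, 0, 2, -1, 1, -2, 1,
  -2, 2, -1, 3, 0, 3, 0, 1, -1, -1, -1, -1, 1, 0, 3, 0, 3, -1, 2, -2, 1, -2, 1, -1, 2, 0, 2, 0, 1], [(94, 97,
  477, 494)]), ([3, 5, 6, 6, 5, 3, 1], [(72, 73, 195, 215), (73, 74, 178, 214), (74, 76, 165, 212), (76, 79,
  150, 209), (79, 81, 149, 184), (81, 83, 147, 165)]), ([2, 2, 2, 3, 3, 2, 2, 2, 1], [(56, 59, 284, 293),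
  (59, 63, 279, 299), (63, 67, 273, 308), (67, 70, 267, 318), (70, 73, 262, 300), (73, 75, 265, 289)]), ([2,
  2, 1], [(92, 95, 231, 241), (95, 97, 229, 253), (97, 99, 228, 264), (99, 101, 227, 277), (101, 106, 226,
  292), (106, 109, 223, 282), (109, 112, 221, 272), (112, 115, 219, 263), (115, 117, 217, 258), (117, 119,
  216, 252), (119, 122, 214, 245), (122, 125, 212, 238), (125, 128, 210, 232), (128, 132, 208, 224), (132,
  135, 205, 218), (135, 138, 203, 213), (138, 141, 200, 208), (141, 145, 198, 202)]), ([-3, 5, -5, 3, 0, -2,
  2, 0, -2, 3, -2, 0, 2, -2, 0, 3, -5, 5, -3, 1], [(355, 359, 451, 460), (359, 363, 443, 454), (363, 367,
  435, 448), (367, 374, 429, 439)]), ([-2, 2, 0, -2, 3, -2, 0, 2, -2, 1], [(296, 301, 396, 406), (301, 306,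
  389, 409), (306, 310, 382, 412), (310, 314, 377, 415), (314, 318, 372, 418), (318, 323, 367, 423), (323,
  327, 361, 429), (327, 330, 357, 436), (330, 333, 354, 442), (333, 336, 350, 450), (336, 339, 347, 460),
  (339, 341, 344, 476)])]"

lemma certificate2_ok: "list_all (entry_ok cos_table) certificate2"
  by code_simp

definition certificate3 :: "entry list" where
  "certificate3 =
  [([4, 9, 14, 17, 17, 14, 9, 4, 1], [(59, 63, 140, 146)]), ([0, 2, 0, 2, -1, 1, -2, 1, -1, 2, 0, 2, 0, 1],
  [(99, 103, 467, 474)]), ([1, 2, 2, 3, 3, 3, 4, 3, 4, 3, 3, 3, 2, 2, 1, 1], [(46, 48, 412, 444)]), ([3, 5,
  5, 2, -2, -4, -2, 3, 7, 7, 3, -2, -4, -2, 2, 5, 5, 3, 1], [(101, 113, 161, 170)]), ([4, 9, 15, 20, 22, 20,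
  14, 5, -5, -13, -16, -13, -5, 5, 14, 20, 22, 20, 15, 9, 4, 1], [(68, 75, 108, 122)]), ([2, 2, 2, 3, 4, 4,
  4, 4, 3, 2, 2, 2, 1], [(56, 58, 268, 280), (58, 62, 257, 274)]), ([3, 5, 6, 6, 6, 7, 8, 8, 7, 6, 6, 6, 5,
  3, 1], [(46, 50, 198, 216), (50, 53, 191, 203)]), ([1, 2, 2, 2, 3, 2, 3, 2, 2, 2, 1, 1], [(53, 55, 398,
  416), (55, 57, 397, 426), (57, 59, 403, 438)]), ([1, 1, 2, 2, 1, 1, 1], [(72, 74, 324, 335), (74, 81, 323,
  343), (81, 84, 320, 338), (84, 88, 318, 331), (88, 91, 316, 326), (91, 94, 314, 321)]), ([1, 1, 2, 1, 1,
  1], [(67, 69, 370, 382), (69, 72, 366, 385), (72, 75, 361, 391), (75, 78, 355, 397), (78, 81, 350, 404),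
  (81, 83, 344, 412), (83, 86, 348, 417), (86, 88, 351, 395), (88, 90, 355, 378)]), ([0, -2, 1, 3, -2, -3, 4,
  2, -5, 0, 5, -1, -4, 2, 3, -2, -2, 2, 2, -2, -2, 3, 2, -4, -1, 5, 0, -5, 2, 4, -3, -2, 3, 1, -2, 0, 1],
  [(257, 263, 300, 326), (263, 269, 303, 316)]), ([1, -1, -1, 1, 1], [(171, 177, 257, 334), (177, 183, 257,
  328), (183, 188, 257, 323), (188, 193, 257, 318), (193, 198, 257, 313), (198, 203, 257, 308), (203, 208,
  257, 303), (208, 213, 257, 298), (213, 218, 257, 293), (218, 223, 257, 288), (223, 228, 257, 283), (228,
  233, 257, 278), (233, 238, 257, 273), (238, 243, 257, 268), (243, 248, 257, 263)]), ([-1, 0, 1, 0, -1, 1],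
  [(257, 259, 342, 480), (259, 262, 342, 467), (262, 265, 342, 457), (265, 268, 342, 449), (268, 272, 342,
  439), (272, 276, 342, 430), (276, 279, 342, 424), (279, 283, 342, 417), (283, 287, 342, 410), (287, 292,
  342, 402), (292, 298, 342, 393), (298, 302, 342, 387), (302, 308, 342, 379), (308, 312, 342, 374), (312,
  316, 342, 369), (316, 322, 342, 362), (322, 327, 342, 356), (327, 331, 342, 352), (331, 335, 342, 347)])]"

lemma certificate3_ok: "list_all (entry_ok cos_table) certificate3"
  by code_simp

definition certificate4 :: "entry list" where
  "certificate4 =
  [([1, 2, 2, 2, 3, 2, 2, 2, 1, 1], [(58, 61, 388, 399)]), ([3, 5, 6, 5, 2, -2, -5, -5, -2, 2, 5, 6, 5, 3,
  1], [(93, 102, 150, 159)]), ([1, 2, 3, 3, 4, 4, 4, 5, 4, 4, 4, 3, 3, 2, 1, 1], [(40, 44, 376, 388)]), ([1,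
  2, 3, 3, 4, 5, 5, 6, 6, 6, 6, 5, 5, 4, 3, 3, 2, 1, 1], [(38, 41, 355, 372)]), ([1, 2, 3, 3, 5, 5, 6, 7, 7,
  8, 8, 8, 8, 7, 7, 6, 5, 5, 3, 3, 2, 1, 1], [(31, 34, 391, 423)]), ([4, 10, 19, 30, 41, 49, 51, 45, 31, 11,
  -11, -30, -41, -41, -30, -11, 11, 31, 45, 51, 49, 41, 30, 19, 10, 4, 1], [(57, 63, 87, 94)]), ([-3, 6, -8,
  8, -5, 0, 5, -7, 5, 0, -5, 8, -8, 6, -3, 1], [(373, 379, 441, 453), (379, 382, 438, 450)]), ([1, 2, 3, 3,
  4, 4, 4, 4, 3, 3, 2, 1, 1], [(44, 46, 389, 411), (46, 50, 362, 403), (50, 53, 368, 397)]), ([3, 4, 3, 1],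
  [(83, 86, 206, 216), (86, 89, 203, 222), (89, 93, 200, 230), (93, 96, 196, 228), (96, 100, 193, 226), (100,
  105, 189, 223), (105, 108, 184, 220), (108, 110, 181, 205), (110, 112, 179, 193), (112, 114, 177, 184)]),
  ([1, 1, 1], [(87, 89, 407, 422), (89, 91, 387, 420), (91, 93, 371, 418), (93, 95, 357, 416), (95, 97, 344,
  414), (97, 99, 333, 412), (99, 101, 323, 410), (101, 106, 314, 405), (106, 109, 320, 402), (109, 112, 326,
  399), (112, 115, 334, 396), (115, 118, 342, 393), (118, 120, 349, 391), (120, 122, 356, 389), (122, 124,
  364, 387), (124, 126, 374, 385)]), ([-1, -1, 3, -1, -3, 4, 1, -5, 2, 4, -4, -1, 4, -1, -2, 1, 1, 0, -1, 0,
  2, -1, -2, 3, 1, -4, 1, 4, -3, -2, 4, 0, -3, 1, 2, -1, -1, 1, 1, -1, -1, 2, 1, -3, 0, 4, -2, -3, 4, 1, -4,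
  1, 3, -2, -1, 2, 0, -1, 0, 1, 1, -2, -1, 4, -1, -4, 4, 2, -5, 1, 4, -3, -1, 3, -1, -1, 1], [(274, 293, 330,
  341)]), ([-2, 2, -1, 1, -2, 3, -2, 1, -1, 2, -2, 1], [(259, 263, 494, 511), (263, 268, 484, 511), (268,
  275, 475, 511), (275, 287, 465, 511), (287, 291, 474, 511), (291, 294, 485, 511), (294, 296, 495, 511)]),
  ([0, -1, 1, 0, 0, 1, -1, 0, 1], [(177, 183, 342, 348), (183, 188, 342, 356), (188, 192, 342, 364), (192,
  196, 342, 372), (196, 200, 342, 381), (200, 203, 342, 392), (203, 210, 342, 401), (210, 214, 342, 395),
  (214, 219, 342, 388), (219, 224, 342, 381), (224, 230, 342, 373), (230, 236, 342, 365), (236, 241, 342,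
  359), (241, 246, 342, 353), (246, 251, 342, 347)])]"

lemma certificate4_ok: "list_all (entry_ok cos_table) certificate4"
  by code_simp

definition certificate5 :: "entry list" where
  "certificate5 =
  [([1, 2, 3, 3, 4, 4, 3, 3, 2, 1, 1], [(55, 59, 372, 385)]), ([2, 2, 3, 4, 4, 4, 5, 5, 4, 4, 4, 3, 2, 2, 1],
  [(45, 49, 301, 319)]), ([2, 2, 3, 5, 6, 6, 7, 8, 7, 6, 6, 5, 3, 2, 2, 1], [(41, 45, 279, 287)]), ([4, 9,
  15, 21, 26, 30, 33, 35, 36, 36, 35, 33, 30, 26, 21, 15, 9, 4, 1], [(34, 37, 112, 135)]), ([3, 5, 5, 2, -2,
  -4, -3, 0, 3, 5, 6, 6, 5, 3, 0, -3, -4, -2, 2, 5, 5, 3, 1], [(97, 101, 171, 181)]), ([1, 1, 2, 1, 0, 1, 0,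
  -1, 1, 0, 0, 2, 1, 1, 2, 0, 0, 1, -1, 0, 1, 0, 1, 2, 1, 1, 1], [(88, 94, 342, 349)]), ([1, 2, 2, 3, 3, 3,
  3, 2, 2, 1, 1], [(49, 50, 425, 461), (50, 53, 417, 458), (53, 56, 432, 455)]), ([-2, 2, 0, -2, 3, -2, 1, 0,
  -1, 3, -4, 3, 0, -2, 2, -1, 1, -1, 0, 2, -3, 2, 0, -1, 1, -1, 2, -2, 0, 3, -4, 3, -1, 0, 1, -2, 3, -2, 0,
  2, -2, 1], [(289, 298, 408, 416)]), ([3, 4, 2, -2, -5, -4, 1, 7, 9, 5, -2, -7, -6, 0, 6, 8, 5, 0, -3, -3,
  -1, 1, 2, 2, 2, 2, 1, -1, -3, -3, 0, 5, 8, 6, 0, -6, -7, -2, 5, 9, 7, 1, -4, -5, -2, 2, 4, 3, 1], [(129,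
  137, 162, 170)]), ([1, 2, 2, 2, 2, 1, 1], [(60, 61, 427, 450), (61, 63, 409, 448), (63, 67, 383, 444), (67,
  70, 388, 441), (70, 73, 394, 438), (73, 76, 400, 435), (76, 79, 407, 432), (79, 82, 416, 429)]), ([-3, 6,
  -9, 11, -11, 9, -5, 0, 5, -8, 8, -5, 1, 2, -2, -1, 6, -11, 14, -13, 8, 0, -8, 14, -16, 14, -9, 4, -1, 2,
  -7, 15, -23, 28, -28, 24, -18, 13, -11, 13, -18, 24, -28, 28, -23, 15, -7, 2, -1, 4, -9, 14, -16, 14, -8,
  0, 8, -13, 14, -11, 6, -1, -2, 2, 1, -5, 8, -8, 5, 0, -5, 9, -11, 11, -9, 6, -3, 1], [(397, 405, 496,
  511)]), ([0, 1, -1, 1, -1, 1, 0, 1], [(119, 121, 496, 511), (121, 124, 486, 511), (124, 129, 475, 511),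
  (129, 133, 462, 511), (133, 142, 454, 511), (142, 148, 460, 511), (148, 153, 465, 511), (153, 159, 473,
  511), (159, 163, 480, 511), (163, 166, 487, 511), (166, 169, 497, 511)]), ([-2, 2, 0, -3, 5, -4, 1, 2, -3,
  2, 0, -1, 1, 0, -1, 2, -2, 1, 1, -3, 4, -3, 1, 1, -2, 2, -1, 0, 1, -1, 0, 2, -3, 2, 1, -4, 5, -3, 0, 2, -2,
  1], [(342, 347, 397, 472), (347, 353, 400, 454), (353, 359, 405, 442), (359, 365, 415, 431)])]"

lemma certificate5_ok: "list_all (entry_ok cos_table) certificate5"
  by code_simp

definition certificate6 :: "entry list" where
  "certificate6 =
  [([2, 2, 2, 3, 4, 4, 3, 2, 2, 2, 1], [(62, 67, 245, 256)]), ([1, 2, 2, 3, 3, 4, 4, 4, 4, 3, 3, 2, 2, 1, 1],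
  [(42, 45, 436, 466)]), ([3, 5, 5, 3, 1], [(87, 90, 189, 198), (90, 93, 182, 195), (93, 96, 176, 192)]),
  ([1, 2, 2, 3, 3, 4, 4, 5, 5, 5, 5, 4, 4, 3, 3, 2, 2, 1, 1], [(38, 40, 453, 471)]), ([0, 2, 0, 3, 0, 3, -1,
  3, -2, 3, -3, 3, -3, 3, -2, 3, -1, 3, 0, 3, 0, 2, 0, 1], [(68, 72, 501, 511)]), ([2, 1, -2, -3, 1, 5, 3,
  -3, -5, 0, 6, 5, -2, -6, -2, 5, 6, 0, -5, -3, 3, 5, 1, -3, -2, 1, 2, 1], [(181, 192, 212, 218)]), ([2, 2,
  3, 4, 4, 4, 4, 3, 2, 2, 1], [(50, 52, 313, 331), (52, 56, 296, 327), (56, 58, 298, 310)]), ([4, 9, 15, 20,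
  22, 20, 15, 9, 4, 1], [(49, 52, 119, 130), (52, 55, 115, 141), (55, 60, 111, 138), (60, 62, 118, 137)]),
  ([1, -1, -2, 1, 4, 1, -4, -3, 3, 5, 0, -4, -2, 2, 3, 1, -1, -2, -1, 2, 4, 1, -4, -4, 2, 6, 2, -4, -4, 1, 4,
  2, -1, -2, -1, 1, 3, 2, -2, -4, 0, 5, 3, -3, -4, 1, 4, 1, -2, -1, 1, 1], [(180, 192, 248, 255)]), ([4, 10,
  19, 30, 41, 50, 55, 55, 50, 41, 30, 19, 10, 4, 1], [(40, 45, 88, 106), (45, 48, 82, 103), (48, 53, 79, 93),
  (53, 55, 74, 86)]), ([2, 1, -1, -1, 1, 2, 1], [(122, 126, 246, 255), (126, 130, 237, 255), (130, 135, 228,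
  255), (135, 140, 219, 255), (140, 144, 210, 255), (144, 148, 204, 255), (148, 153, 198, 255), (153, 158,
  191, 255), (158, 164, 185, 255), (164, 170, 178, 255)]), ([3, 4, 2, -2, -4, -2, 2, 4, 3, 1], [(113, 116,
  189, 206), (116, 118, 177, 211), (118, 126, 171, 209), (126, 134, 171, 203), (134, 139, 171, 199), (139,
  145, 171, 194), (145, 151, 171, 189), (151, 157, 171, 183), (157, 163, 171, 178)]), ([-1, 0, 1, 0, 0, -1,
  1, 1, -1, 0, 0, 1, 0, -1, 1], [(209, 213, 403, 412), (213, 218, 397, 415), (218, 223, 390, 419), (223, 228,
  383, 423), (228, 231, 376, 428), (231, 235, 372, 432), (235, 238, 367, 437), (238, 243, 363, 442), (243,
  247, 357, 451), (247, 250, 352, 460), (250, 253, 349, 469), (253, 255, 345, 481)])]"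

lemma certificate6_ok: "list_all (entry_ok cos_table) certificate6"
  by code_simp

definition certificate7 :: "entry list" where
  "certificate7 =
  [([2, 2, 3, 4, 3, 3, 4, 3, 2, 2, 1], [(59, 61, 304, 316)]), ([4, 9, 15, 20, 23, 24, 24, 24, 24, 23, 20, 15,
  9, 4, 1], [(41, 44, 137, 152)]), ([2, 2, 2, 3, 4, 4, 4, 5, 5, 4, 4, 4, 3, 2, 2, 2, 1], [(49, 54, 268,
  280)]), ([0, 2, 0, 3, -1, 3, -2, 3, -3, 3, -3, 3, -2, 3, -1, 3, 0, 2, 0, 1], [(75, 81, 498, 511)]), ([1, 1,
  2, 2, 2, 3, 2, 2, 2, 1, 1, 1], [(56, 60, 356, 367), (60, 64, 346, 369)]), ([1, 2, 3, 3, 5, 5, 6, 7, 7, 8,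
  8, 8, 9, 8, 9, 8, 8, 8, 7, 7, 6, 5, 5, 3, 3, 2, 1, 1], [(28, 30, 401, 421)]), ([3, 5, 6, 7, 9, 11, 12, 12,
  12, 12, 11, 9, 7, 6, 5, 3, 1], [(37, 40, 226, 242), (40, 42, 206, 229)]), ([1, -1, -2, 1, 4, 1, -4, -3, 3,
  5, 0, -5, -2, 5, 5, -3, -7, 0, 8, 4, -6, -6, 4, 8, 0, -7, -3, 5, 5, -2, -5, 0, 5, 3, -3, -4, 1, 4, 1, -2,
  -1, 1, 1], [(206, 214, 224, 239)]), ([3, 4, 3, 2, 2, 2, 1, 0, 0, 1, 2, 2, 2, 3, 4, 3, 1], [(74, 77, 227,
  238), (77, 83, 217, 235), (83, 86, 223, 233)]), ([0, 2, -1, 2, -2, 2, -2, 2, -1, 2, 0, 1], [(98, 101, 491,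
  511), (101, 105, 480, 511), (105, 111, 470, 511), (111, 114, 480, 511), (114, 116, 490, 511)]), ([3, 5, 6,
  6, 6, 6, 5, 3, 1], [(54, 56, 218, 230), (56, 59, 209, 227), (59, 62, 197, 225), (62, 65, 186, 222), (65,
  68, 177, 219), (68, 71, 168, 217), (71, 72, 161, 194), (72, 73, 158, 177)]), ([-3, 6, -9, 11, -11, 10, -9,
  9, -10, 12, -14, 15, -14, 12, -10, 9, -9, 10, -11, 11, -9, 6, -3, 1], [(346, 353, 501, 511), (353, 362,
  494, 511), (362, 384, 487, 511), (384, 391, 497, 511)]), ([-2, 2, -1, 1, -2, 3, -2, 0, 1, 0, -1, 1, 0, 0,
  -1, 2, -1, -1, 2, -1, 0, 0, 1, -1, 0, 1, 0, -2, 3, -2, 1, -1, 2, -2, 1], [(299, 302, 465, 511), (302, 312,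
  439, 511), (312, 322, 449, 511), (322, 329, 459, 511), (329, 334, 470, 511), (334, 339, 487, 511)])]"

lemma certificate7_ok: "list_all (entry_ok cos_table) certificate7"
  by code_simp

definition certificate8 :: "entry list" where
  "certificate8 =
  [([3, 5, 6, 5, 3, 1], [(81, 82, 185, 201), (82, 84, 179, 196)]), ([4, 8, 11, 11, 8, 4, 1], [(67, 73, 148,
  151), (73, 79, 144, 148)]), ([2, 2, 3, 4, 4, 5, 6, 6, 6, 6, 5, 4, 4, 3, 2, 2, 1], [(41, 43, 312, 331)]),
  ([3, 5, 5, 2, -3, -7, -7, -2, 6, 12, 12, 6, -2, -7, -7, -3, 2, 5, 5, 3, 1], [(113, 117, 149, 160)]), ([1,
  1, 2, 1, 0, 1, 0, -1, 1, 1, 0, 2, 2, 0, 1, 1, -1, 0, 1, 0, 1, 2, 1, 1, 1], [(89, 95, 330, 341)]), ([1, 1,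
  2, 2, 2, 2, 1, 1, 1], [(66, 68, 351, 367), (68, 71, 334, 362), (71, 73, 340, 358)]), ([2, 2, 2, 3, 4, 3, 1,
  0, 0, -1, -2, -1, 1, 2, 2, 3, 5, 5, 3, 2, 2, 1, -1, -2, -1, 0, 0, 1, 3, 4, 3, 2, 2, 2, 1], [(73, 78, 240,
  249)]), ([0, 2, 0, 3, 0, 4, 0, 4, 0, 3, 0, 2, 0, 1], [(45, 51, 468, 475), (51, 56, 475, 484), (56, 60, 482,
  496)]), ([0, 2, 0, 3, 0, 3, 0, 2, 0, 1], [(53, 57, 460, 470), (57, 61, 456, 476), (61, 65, 461, 483), (65,
  69, 466, 495), (69, 72, 471, 486)]), ([2, 2, 2, 2, 1], [(72, 74, 306, 322), (74, 76, 295, 321), (76, 79,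
  284, 320), (79, 81, 270, 319), (81, 84, 262, 317), (84, 87, 250, 316), (87, 92, 242, 313), (92, 95, 254,
  311), (95, 97, 265, 310), (97, 99, 278, 309), (99, 101, 294, 308)]), ([-3, 6, -9, 11, -11, 9, -5, 0, 5, -8,
  8, -5, 1, 2, -2, -1, 6, -11, 14, -13, 8, 0, -8, 14, -16, 14, -9, 4, -1, 2, -7, 15, -23, 28, -28, 23, -14,
  4, 4, -7, 4, 4, -14, 23, -28, 28, -23, 15, -7, 2, -1, 4, -9, 14, -16, 14, -8, 0, 8, -13, 14, -11, 6, -1,
  -2, 2, 1, -5, 8, -8, 5, 0, -5, 9, -11, 11, -9, 6, -3, 1], [(408, 414, 497, 511)]), ([0, -1, 1, 1, -1, 0,
  1], [(178, 184, 335, 341), (184, 190, 329, 341), (190, 196, 323, 341), (196, 202, 317, 341), (202, 208,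
  311, 341), (208, 214, 305, 341), (214, 220, 299, 341), (220, 226, 293, 341), (226, 232, 287, 341), (232,
  238, 281, 341), (238, 244, 275, 341), (244, 250, 269, 341), (250, 255, 263, 341)])]"

lemma certificate8_ok: "list_all (entry_ok cos_table) certificate8"
  by code_simp

text \<open>The division into eight pieces has no mathematical meaning; each piece is evaluated
  separately, and only distinctness and total area concern the whole list.\<close>

definition certificate :: "entry list" where
  "certificate =    certificate1 @ certificate2 @ certificate3 @ certificate4 @ certificate5 @ certificate6 @
    certificate7 @ certificate8"

lemma distinct_certificate: "distinct (map fst certificate)"
  by code_simp

lemma area_certificate: "4 * (\<Sum>e\<leftarrow>certificate. area (snd e)) > 262144"
  by code_simp

theorem theorem2:
  fixes beta :: real
  assumes "salem_number_deg 6 beta"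
  shows "liminf (\<lambda>M::nat. ereal (real (card {m \<in> {1..M}. \<exists>p. mp_periodic (beta_exp_one (beta ^ m)) 1 p}) / real M))
           > ereal (1/2)"
proof (rule density_from_certificate[OF assms bounds_ok_cos_table _ distinct_certificate area_certificate])
  show "list_all (entry_ok cos_table) certificate"
    unfolding certificate_def list_all_append
    by (intro conjI certificate1_ok certificate2_ok certificate3_ok certificate4_ok certificate5_ok certificate6_ok certificate7_ok certificate8_ok)
qed

end
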